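(* Let $(X,\mathcal{M})$ be a multi-normed vector lattice (MNVL). The following are equivalent: (1) Any $m$-bounded and $um$-closed subset $A$ of $X$ is $um$-compact. (2) $X$ is an atomic vector lattice and $(X,\mathcal{M})$ has the Lebesgue and Levi properties.
   Context: A multi-normed vector lattice (MNVL) $(X,\mathcal{M})$ is a real vector lattice $X$ together with a separating, upward directed family $\mathcal{M}=\{m_\lambda\}_{\lambda\in\Lambda}$ of lattice seminorms on $X$ (seminorms with $|x|\le|y|\Rightarrow m_\lambda(x)\le m_\lambda(y)$). The $m$-topology is the Hausdorff locally convex-solid topology generated by $\mathcal{M}$; a net $x_\alpha$ $m$-converges to $x$ ($x_\alpha\xrightarrow{m}x$) iff $m_\lambda(x_\alpha-x)\to0$ for every $\lambda\in\Lambda$. A subset $A\subseteq X$ is $m$-bounded if $\sup_{a\in A}m_\lambda(a)<\infty$ for every $\lambda\in\Lambda$. A net $x_\alpha$ in $X$ is $um$-convergent to $x$ if $|x_\alpha-x|\wedge u\xrightarrow{m}0$ for every $u\in X_+$. This is convergence with respect to a Hausdorff locally solid linear topology, the $um$-topology, which has a base of neighborhoods at zero consisting of the sets $\{x\in X: m_\lambda(|x|\wedge u)<\varepsilon\}$, $\varepsilon>0$, $0\ne u\in X_+$, $\lambda\in\Lambda$. A subset is $um$-closed ($um$-compact) if it is closed (compact) in the $um$-topology. $(X,\mathcal{M})$ has the Lebesgue property if $x_\alpha\downarrow0$ (nets) implies $x_\alpha\xrightarrow{m}0$; the Levi property if every net with $0\le x_\alpha\uparrow$ that is $m$-bounded satisfies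 $x_\alpha\uparrow x$ for some $x\in X$. An atom of $X$ is an element $e>0$ whose generated ideal is $\operatorname{span}\{e\}$; $X$ is atomic if it has a maximal orthogonal system consisting of atoms, i.e. a family $\{e_\gamma\}_{\gamma\in\Gamma}$ of pairwise disjoint atoms such that $x\in X_+$ and $x\wedge e_\gamma=0$ for all $\gamma$ imply $x=0$. *)

theory Defs
  imports
    "HOL-Analysis.Analysis"
    "HOL-Library.Lattice_Algebras"
    "HOL-Library.Lub_Glb"
begin

class vector_lattice = ordered_real_vector + lattice_ab_group_add_abs

definition lattice_seminorm :: "('a::vector_lattice \<Rightarrow> real) \<Rightarrow> bool" where
  "lattice_seminorm p \<longleftrightarrow>
     (\<forall>x y. p (x + y) \<le> p x + p y) \<and>
     (\<forall>c x. p (c *\<^sub>R x) = \<bar>c\<bar> * p x) \<and>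
     (\<forall>x y. \<bar>x\<bar> \<le> \<bar>y\<bar> \<longrightarrow> p x \<le> p y)"

text \<open>A family of seminorms is given as a set of functions: no notion below depends on the indexing.
  Upward directed families are nonempty.\<close>

definition mnvl :: "('a::vector_lattice \<Rightarrow> real) set \<Rightarrow> bool" where
  "mnvl M \<longleftrightarrow>
     (\<forall>p\<in>M. lattice_seminorm p) \<and>
     (\<forall>x. x \<noteq> 0 \<longrightarrow> (\<exists>p\<in>M. p x \<noteq> 0)) \<and>
     M \<noteq> {} \<and> (\<forall>p\<in>M. \<forall>q\<in>M. \<exists>r\<in>M. \<forall>x. p x \<le> r x \<and> q x \<le> r x)"

definition m_bounded :: "('a::vector_lattice \<Rightarrow> real) set \<Rightarrow> 'a set \<Rightarrow> bool" where
  "m_bounded M A \<longleftrightarrow> (\<forall>p\<in>M. bdd_above (p ` A))"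

definition um_ball :: "('a::vector_lattice \<Rightarrow> real) \<Rightarrow> 'a \<Rightarrow> real \<Rightarrow> 'a set" where
  "um_ball p u e = {x. p (inf \<bar>x\<bar> u) < e}"

text \<open>The translation-invariant topology with the sets \<open>um_ball p u e\<close> as a base of neighbourhoods
  of zero. Admitting \<open>u = 0\<close>, whose ball is the whole space, changes the topology only on the zero
  space, where there is no other \<open>u\<close> and the base would otherwise be empty.\<close>

definition um_topology :: "('a::vector_lattice \<Rightarrow> real) set \<Rightarrow> 'a topology" where
  "um_topology M =
     topology (\<lambda>U. \<forall>x\<in>U. \<exists>p\<in>M. \<exists>u\<ge>0. \<exists>e>0. (+) x ` um_ball p u e \<subseteq> U)"

definition directed_index :: "'i set \<Rightarrow> ('i \<Rightarrow> 'i \<Rightarrow> bool) \<Rightarrow> bool" where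
  "directed_index I le \<longleftrightarrow>
     I \<noteq> {} \<and> reflp_on I le \<and> transp_on I le \<and> (\<forall>i\<in>I. \<forall>j\<in>I. \<exists>k\<in>I. le i k \<and> le j k)"

definition m_converges ::
  "('a::vector_lattice \<Rightarrow> real) set \<Rightarrow> 'i set \<Rightarrow> ('i \<Rightarrow> 'i \<Rightarrow> bool) \<Rightarrow> ('i \<Rightarrow> 'a) \<Rightarrow> 'a \<Rightarrow> bool" where
  "m_converges M I le x l \<longleftrightarrow>
     (\<forall>p\<in>M. \<forall>e>0. \<exists>i\<in>I. \<forall>j\<in>I. le i j \<longrightarrow> p (x j - l) < e)"

definition decreases_to ::
  "'i set \<Rightarrow> ('i \<Rightarrow> 'i \<Rightarrow> bool) \<Rightarrow> ('i \<Rightarrow> 'a::vector_lattice) \<Rightarrow> 'a \<Rightarrow> bool" where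
  "decreases_to I le x l \<longleftrightarrow> monotone_on I le (\<ge>) x \<and> isGlb UNIV (x ` I) l"

definition increases_to ::
  "'i set \<Rightarrow> ('i \<Rightarrow> 'i \<Rightarrow> bool) \<Rightarrow> ('i \<Rightarrow> 'a::vector_lattice) \<Rightarrow> 'a \<Rightarrow> bool" where
  "increases_to I le x l \<longleftrightarrow> monotone_on I le (\<le>) x \<and> isLub UNIV (x ` I) l"

text \<open>Quantification over types is not available inside a definition, so the nets in the next two
  definitions have index sets in the type of the space itself. As the nets are monotone this is no
  restriction: lemmas \<open>lebesgue_property_net\<close> and \<open>levi_property_net\<close> below cover nets over
  index sets of any type.\<close>

definition lebesgue_property :: "('a::vector_lattice \<Rightarrow> real) set \<Rightarrow> bool" where
  "lebesgue_property M \<longleftrightarrow>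
     (\<forall>(I :: 'a set) le x. directed_index I le \<and> decreases_to I le x 0 \<longrightarrow> m_converges M I le x 0)"

definition levi_property :: "('a::vector_lattice \<Rightarrow> real) set \<Rightarrow> bool" where
  "levi_property M \<longleftrightarrow>
     (\<forall>(I :: 'a set) le x.
        directed_index I le \<and> (\<forall>i\<in>I. 0 \<le> x i) \<and> monotone_on I le (\<le>) x \<and> m_bounded M (x ` I) \<longrightarrow>
        (\<exists>l. increases_to I le x l))"

definition order_ideal :: "'a::vector_lattice set \<Rightarrow> bool" where
  "order_ideal J \<longleftrightarrow> subspace J \<and> (\<forall>x y. y \<in> J \<and> \<bar>x\<bar> \<le> \<bar>y\<bar> \<longrightarrow> x \<in> J)"

definition atom :: "'a::vector_lattice \<Rightarrow> bool" where
  "atom e \<longleftrightarrow> 0 < e \<and> order_ideal hull {e} = span {e}"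

definition atomic_vector_lattice :: "'a::vector_lattice itself \<Rightarrow> bool" where
  "atomic_vector_lattice _ \<longleftrightarrow>
     (\<exists>E :: 'a set. (\<forall>e\<in>E. atom e) \<and> pairwise (\<lambda>e f. inf e f = 0) E \<and>
        (\<forall>x\<ge>0. (\<forall>e\<in>E. inf x e = 0) \<longrightarrow> x = 0))"

lemma lebesgue_property_net:
  fixes x :: "'i \<Rightarrow> 'a::vector_lattice"
  assumes "lebesgue_property M" "directed_index I le" "decreases_to I le x 0"
  shows "m_converges M I le x 0"
proof -
  have mono: "x j \<le> x i" if "i \<in> I" "j \<in> I" "le i j" for i j
    using assms(3) that by (auto simp: decreases_to_def monotone_on_def)
  have "directed_index (x ` I) (\<ge>)"
    unfolding directed_index_def
  proof (intro conjI ballI)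
    show "x ` I \<noteq> {}" using assms(2) by (auto simp: directed_index_def)
    show "reflp_on (x ` I) (\<ge>)" by (auto simp: reflp_on_def)
    show "transp_on (x ` I) (\<ge>)" by (auto simp: transp_on_def)
    fix a b assume "a \<in> x ` I" "b \<in> x ` I"
    then obtain i j where ij: "i \<in> I" "a = x i" "j \<in> I" "b = x j" by auto
    then obtain k where "k \<in> I" "le i k" "le j k"
      using assms(2) by (auto simp: directed_index_def)
    then show "\<exists>c\<in>x ` I. c \<le> a \<and> c \<le> b" using mono ij by blast
  qed
  moreover have "decreases_to (x ` I) (\<ge>) id 0"
    using assms(3) by (auto simp: decreases_to_def monotone_on_def)
  ultimately have conv: "m_converges M (x ` I) (\<ge>) id 0"
    using assms(1) unfolding lebesgue_property_def by blast
  show ?thesis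
    unfolding m_converges_def
  proof (intro ballI allI impI)
    fix p :: "'a \<Rightarrow> real" and e :: real
    assume "p \<in> M" "0 < e"
    then obtain a where "a \<in> x ` I" "\<forall>b\<in>x ` I. b \<le> a \<longrightarrow> p (id b - 0) < e"
      using conv unfolding m_converges_def by blast
    then obtain i where "i \<in> I" "\<forall>b\<in>x ` I. b \<le> x i \<longrightarrow> p (b - 0) < e" by auto
    then show "\<exists>i\<in>I. \<forall>j\<in>I. le i j \<longrightarrow> p (x j - 0) < e" using mono by blast
  qed
qed

lemma levi_property_net:
  fixes x :: "'i \<Rightarrow> 'a::vector_lattice"
  assumes "levi_property M" "directed_index I le" "\<And>i. i \<in> I \<Longrightarrow> 0 \<le> x i"
    and "monotone_on I le (\<le>) x" "m_bounded M (x ` I)"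
  shows "\<exists>l. increases_to I le x l"
proof -
  have "directed_index (x ` I) (\<le>)"
    unfolding directed_index_def
  proof (intro conjI ballI)
    show "x ` I \<noteq> {}" using assms(2) by (auto simp: directed_index_def)
    show "reflp_on (x ` I) (\<le>)" by (auto simp: reflp_on_def)
    show "transp_on (x ` I) (\<le>)" by (auto simp: transp_on_def)
    fix a b assume "a \<in> x ` I" "b \<in> x ` I"
    then obtain i j where ij: "i \<in> I" "a = x i" "j \<in> I" "b = x j" by auto
    then obtain k where "k \<in> I" "le i k" "le j k"
      using assms(2) by (auto simp: directed_index_def)
    then show "\<exists>c\<in>x ` I. a \<le> c \<and> b \<le> c"
      using assms(4) ij by (auto simp: monotone_on_def)
  qed
  moreover have "monotone_on (x ` I) (\<le>) (\<le>) id" by (auto simp: monotone_on_def)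
  moreover have "\<forall>i\<in>x ` I. 0 \<le> id i" using assms(3) by auto
  moreover have "m_bounded M (id ` x ` I)" using assms(5) by simp
  ultimately obtain l where "increases_to (x ` I) (\<le>) id l"
    using assms(1) unfolding levi_property_def by blast
  then show ?thesis using assms(4) by (auto simp: increases_to_def)
qed

lemma lattice_seminorm_zero: "lattice_seminorm p \<Longrightarrow> p 0 = 0"
  unfolding lattice_seminorm_def by (metis abs_zero mult_zero_left scaleR_zero_left)

lemma lattice_seminorm_mono: "lattice_seminorm p \<Longrightarrow> 0 \<le> x \<Longrightarrow> x \<le> y \<Longrightarrow> p x \<le> p y"
  unfolding lattice_seminorm_def by (metis abs_of_nonneg order_trans)

lemma lattice_seminorm_nonneg: "lattice_seminorm p \<Longrightarrow> 0 \<le> p x"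
  using lattice_seminorm_zero[of p] unfolding lattice_seminorm_def by (metis abs_ge_zero abs_zero)

lemma inf_abs_add_le:
  fixes x y u :: "'a::vector_lattice"
  assumes "0 \<le> u"
  shows "inf \<bar>x + y\<bar> u \<le> inf \<bar>x\<bar> u + inf \<bar>y\<bar> u"
proof -
  have "inf \<bar>x + y\<bar> u \<le> \<bar>x\<bar> + \<bar>y\<bar>"
    using abs_triangle_ineq[of x y] by (meson inf_le1 order_trans)
  moreover have "inf \<bar>x + y\<bar> u \<le> \<bar>x\<bar> + u" "inf \<bar>x + y\<bar> u \<le> u + \<bar>y\<bar>" "inf \<bar>x + y\<bar> u \<le> u + u"
    using assms by (auto intro: le_infI2 add_increasing add_increasing2)
  ultimately show ?thesis
    by (simp add: add_inf_distrib_left add_inf_distrib_right)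
qed

lemma um_ball_add:
  assumes "lattice_seminorm p" "0 \<le> u" "x \<in> um_ball p u d" "y \<in> um_ball p u e"
  shows "x + y \<in> um_ball p u (d + e)"
proof -
  have "p (inf \<bar>x + y\<bar> u) \<le> p (inf \<bar>x\<bar> u + inf \<bar>y\<bar> u)"
    using assms by (intro lattice_seminorm_mono inf_abs_add_le) auto
  also have "\<dots> \<le> p (inf \<bar>x\<bar> u) + p (inf \<bar>y\<bar> u)"
    using assms(1) by (simp add: lattice_seminorm_def)
  finally show ?thesis using assms by (auto simp: um_ball_def)
qed

lemma um_ball_mono:
  assumes "lattice_seminorm p" "0 \<le> u" "u \<le> v" "d \<le> e" "\<And>x. p x \<le> q x"
  shows "um_ball q v d \<subseteq> um_ball p u e"
proof
  fix x assume "x \<in> um_ball q v d"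
  then have "q (inf \<bar>x\<bar> v) < e" using assms(4) by (auto simp: um_ball_def)
  moreover have "p (inf \<bar>x\<bar> u) \<le> p (inf \<bar>x\<bar> v)"
    using assms by (intro lattice_seminorm_mono) (auto intro: le_infI2)
  ultimately show "x \<in> um_ball p u e"
    using assms(5)[of "inf \<bar>x\<bar> v"] by (auto simp: um_ball_def)
qed

lemma openin_um_topology:
  assumes "mnvl M"
  shows "openin (um_topology M) U \<longleftrightarrow>
    (\<forall>x\<in>U. \<exists>p\<in>M. \<exists>u\<ge>0. \<exists>e>0. (+) x ` um_ball p u e \<subseteq> U)"
proof -
  let ?P = "\<lambda>U. \<forall>x\<in>U. \<exists>p\<in>M. \<exists>u\<ge>0. \<exists>e>0. (+) x ` um_ball p u e \<subseteq> U"
  have inter: "?P (S \<inter> T)" if PS: "?P S" and PT: "?P T" for S T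
  proof
    fix x assume x: "x \<in> S \<inter> T"
    obtain p u d where p: "p \<in> M" "u \<ge> 0" "d > 0" "(+) x ` um_ball p u d \<subseteq> S"
      using PS x by blast
    obtain q v e where q: "q \<in> M" "v \<ge> 0" "e > 0" "(+) x ` um_ball q v e \<subseteq> T"
      using PT x by blast
    obtain r where r: "r \<in> M" "\<And>x. p x \<le> r x" "\<And>x. q x \<le> r x"
      using assms p(1) q(1) unfolding mnvl_def by meson
    have pq: "lattice_seminorm p" "lattice_seminorm q"
      using assms p q by (auto simp: mnvl_def)
    have "um_ball r (sup u v) (min d e) \<subseteq> um_ball p u d"
      by (rule um_ball_mono) (use p r pq in auto)
    moreover have "um_ball r (sup u v) (min d e) \<subseteq> um_ball q v e"
      by (rule um_ball_mono) (use q r pq in auto)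
    ultimately have "(+) x ` um_ball r (sup u v) (min d e) \<subseteq> S \<inter> T" using p q by blast
    moreover have "sup u v \<ge> 0" "min d e > 0" using p q by (auto intro: le_supI1)
    ultimately show "\<exists>p\<in>M. \<exists>u\<ge>0. \<exists>e>0. (+) x ` um_ball p u e \<subseteq> S \<inter> T" using r by blast
  qed
  have "?P (\<Union>K)" if PK: "\<forall>S\<in>K. ?P S" for K
  proof
    fix x assume "x \<in> \<Union>K"
    then obtain S where S: "S \<in> K" "x \<in> S" by blast
    then obtain p u e where "p \<in> M" "u \<ge> 0" "e > 0" "(+) x ` um_ball p u e \<subseteq> S"
      using PK by blast
    then show "\<exists>p\<in>M. \<exists>u\<ge>0. \<exists>e>0. (+) x ` um_ball p u e \<subseteq> \<Union>K" using S by blast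
  qed
  with inter have "istopology ?P" unfolding istopology_def by blast
  then show ?thesis by (simp add: um_topology_def)
qed

lemma topspace_um_topology [simp]:
  assumes "mnvl M"
  shows "topspace (um_topology M) = UNIV"
proof -
  obtain p where "p \<in> M" using assms by (auto simp: mnvl_def)
  then have "openin (um_topology M) UNIV"
    using zero_less_one by (subst openin_um_topology[OF assms]) blast
  then show ?thesis using openin_subset by blast
qed

lemma um_ball_neighbourhood:
  fixes a :: "'a::vector_lattice"
  assumes "mnvl M" "p \<in> M" "u \<ge> 0" "e > 0"
  shows "\<exists>U. openin (um_topology M) U \<and> a \<in> U \<and> U \<subseteq> (+) a ` um_ball p u e"
proof -
  have p: "lattice_seminorm p" using assms by (auto simp: mnvl_def)
  define U where "U = {y. \<exists>d>0. (+) y ` um_ball p u d \<subseteq> (+) a ` um_ball p u e}"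
  have zero: "0 \<in> um_ball p u d" if "d > 0" for d
    using that assms(3) lattice_seminorm_zero[OF p] by (simp add: um_ball_def inf_absorb1)
  have "openin (um_topology M) U"
    unfolding openin_um_topology[OF assms(1)]
  proof
    fix y assume "y \<in> U"
    then obtain d where d: "d > 0" "(+) y ` um_ball p u d \<subseteq> (+) a ` um_ball p u e"
      by (auto simp: U_def)
    have "(+) y ` um_ball p u (d/2) \<subseteq> U"
    proof
      fix z assume "z \<in> (+) y ` um_ball p u (d/2)"
      then obtain v where v: "z = y + v" "v \<in> um_ball p u (d/2)" by auto
      have "(+) z ` um_ball p u (d/2) \<subseteq> (+) y ` um_ball p u d"
      proof
        fix w assume "w \<in> (+) z ` um_ball p u (d/2)"
        then obtain t where t: "w = z + t" "t \<in> um_ball p u (d/2)" by auto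
        have "v + t \<in> um_ball p u d"
          using um_ball_add[OF p assms(3) v(2) t(2)] by simp
        then show "w \<in> (+) y ` um_ball p u d" using t v by (auto simp: add.assoc)
      qed
      then have "(+) z ` um_ball p u (d/2) \<subseteq> (+) a ` um_ball p u e" using d by blast
      then show "z \<in> U" using d by (auto simp: U_def intro!: exI[of _ "d/2"])
    qed
    then show "\<exists>p\<in>M. \<exists>u\<ge>0. \<exists>e>0. (+) y ` um_ball p u e \<subseteq> U"
      using assms d half_gt_zero by blast
  qed
  moreover have "a \<in> U" using assms by (auto simp: U_def)
  moreover have "U \<subseteq> (+) a ` um_ball p u e"
  proof
    fix y assume "y \<in> U"
    then obtain d where d: "d > 0" "(+) y ` um_ball p u d \<subseteq> (+) a ` um_ball p u e"
      by (auto simp: U_def)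
    have "y \<in> (+) y ` um_ball p u d"
      using zero[OF d(1)] by (metis add.right_neutral image_eqI)
    then show "y \<in> (+) a ` um_ball p u e" using d by blast
  qed
  ultimately show ?thesis by blast
qed

text \<open>Convergence in \<open>um_topology M\<close> is um-convergence.\<close>

lemma limitin_um_topology:
  assumes "mnvl M"
  shows "limitin (um_topology M) f l F \<longleftrightarrow>
    (\<forall>u\<ge>0. \<forall>p\<in>M. ((\<lambda>i. p (inf \<bar>f i - l\<bar> u)) \<longlongrightarrow> 0) F)"
proof
  assume L: "limitin (um_topology M) f l F"
  show "\<forall>u\<ge>0. \<forall>p\<in>M. ((\<lambda>i. p (inf \<bar>f i - l\<bar> u)) \<longlongrightarrow> 0) F"
  proof (intro allI impI ballI tendstoI)
    fix u :: 'a and p and e :: real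
    assume u: "0 \<le> u" and p: "p \<in> M" and e: "e > 0"
    obtain U where U: "openin (um_topology M) U" "l \<in> U" "U \<subseteq> (+) l ` um_ball p u e"
      using um_ball_neighbourhood[OF assms p u e] by blast
    have "lattice_seminorm p" using assms p by (auto simp: mnvl_def)
    then have nn: "0 \<le> p x" for x by (rule lattice_seminorm_nonneg)
    have "eventually (\<lambda>i. f i \<in> U) F" using L U by (auto simp: limitin_def)
    then show "\<forall>\<^sub>F i in F. dist (p (inf \<bar>f i - l\<bar> u)) 0 < e"
    proof eventually_elim
      case (elim i)
      then have "f i \<in> (+) l ` um_ball p u e" using U by blast
      then have "f i - l \<in> um_ball p u e" by auto
      then show ?case using nn by (simp add: um_ball_def)
    qed
  qed
next
  assume R: "\<forall>u\<ge>0. \<forall>p\<in>M. ((\<lambda>i. p (inf \<bar>f i - l\<bar> u)) \<longlongrightarrow> 0) F"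
  show "limitin (um_topology M) f l F"
    unfolding limitin_def
  proof (intro conjI allI impI)
    show "l \<in> topspace (um_topology M)" using assms by simp
    fix U assume "openin (um_topology M) U \<and> l \<in> U"
    then obtain p u e where
      *: "p \<in> M" "u \<ge> 0" "e > 0" "(+) l ` um_ball p u e \<subseteq> U"
      using openin_um_topology[OF assms] by blast
    then have "\<forall>\<^sub>F i in F. p (inf \<bar>f i - l\<bar> u) < e"
      using R order_tendstoD(2) by blast
    then show "\<forall>\<^sub>F i in F. f i \<in> U"
    proof eventually_elim
      case (elim i)
      then have "l + (f i - l) \<in> U" using * by (auto simp: um_ball_def)
      then show ?case by simp
    qed
  qed
qed

end

theory Submission
  imports Defs
begin

text \<open>For (2) implies (1), fix a maximal disjoint system \<open>E\<close> of atoms. By the Levi property every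
  family of coordinates whose finite partial sums satisfy given seminorm bounds is the coordinate
  family of an element, and by the Lebesgue property the um-topology on such elements is that
  of coordinatewise convergence. So an m-bounded um-closed set is a closed subset of a continuous
  image of a closed subset of a product of compact intervals.

  For (1) implies (2), the sets given by seminorm bounds are um-closed, hence compact, and a cluster
  point of a bounded monotone net is its supremum or infimum; this yields the Levi and Lebesgue
  properties. For atomicity, suppose that no atom lies below \<open>u > 0\<close>. Choose a seminorm \<open>p\<close> with
  \<open>p u > 0\<close> and a positive functional \<open>f \<le> p\<close> with \<open>f u = p u\<close>. Every \<open>w \<le> u\<close> splits into two disjoint
  parts each of which carries at least a quarter of the \<open>f\<close>-mass. Iterating the splitting gives
  arbitrarily many elements of \<open>[0, u]\<close> with mutual distance at least \<open>p u / 4\<close>, so \<open>[0, u]\<close> is not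
  totally bounded, hence not compact.\<close>

subsection \<open>Disjointness in vector lattices\<close>

text \<open>The um-topology sees an element only through its truncations
  \<open>inf \<bar>x\<bar> u\<close>. With atoms this is an advantage: the part of a truncation
  outside finitely many atoms is dominated by the corresponding part of \<open>u\<close>, uniformly
  in \<open>x\<close>. For atomicity it does no harm: differences of points of \<open>[0, u]\<close>
  lie below \<open>u\<close>, so truncating at \<open>u\<close> changes nothing. The functional
  \<open>f\<close> is there because \<open>p\<close> is only subadditive on disjoint sums. Mass
  measured by \<open>f\<close> adds up exactly, and \<open>f \<le> p\<close> turns separation for
  \<open>f\<close> into separation for \<open>p\<close>. The quarter is chosen so that large
  components are closed under meets. Without a splitting, a component carries less than 1/4 or more
  than 3/4 of the mass; two of the latter kind meet in more than 1/2, hence again in more than 3/4.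
  The Levi and Lebesgue properties come before atomicity because that argument uses them: Levi
  supplies band projections and the infimum of the large components, Lebesgue keeps the mass of that
  infimum positive.\<close>

lemma disjoint_nonneg:
  fixes a b :: "'a::vector_lattice"
  assumes "inf a b = 0"
  shows "0 \<le> a" "0 \<le> b"
  by (metis assms inf_le1, metis assms inf_le2)

lemma disjoint_mono:
  fixes a b c d :: "'a::vector_lattice"
  assumes "inf a b = 0" "0 \<le> c" "c \<le> a" "0 \<le> d" "d \<le> b"
  shows "inf c d = 0"
proof (rule antisym)
  show "inf c d \<le> 0" using inf_mono[OF assms(3,5)] unfolding assms(1) .
  show "0 \<le> inf c d" using assms by simp
qed

lemma disjoint_self:
  fixes a :: "'a::vector_lattice"
  assumes "inf a b = 0" "a \<le> b"
  shows "a = 0"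
  using assms by (simp add: inf_absorb1)

lemma inf_add_le:
  fixes a b c :: "'a::vector_lattice"
  assumes "0 \<le> a" "0 \<le> b" "0 \<le> c"
  shows "inf a (b + c) \<le> inf a b + inf a c"
proof -
  have "inf a (b + c) \<le> a + a" "inf a (b + c) \<le> a + c" "inf a (b + c) \<le> b + a"
    using assms by (auto intro: le_infI1 add_increasing add_increasing2)
  then show ?thesis
    by (simp add: add_inf_distrib_left add_inf_distrib_right)
qed

lemma disjoint_add:
  fixes a b c :: "'a::vector_lattice"
  assumes "inf a b = 0" "inf a c = 0"
  shows "inf a (b + c) = 0"
proof (rule antisym)
  show "inf a (b + c) \<le> 0"
    using inf_add_le[OF disjoint_nonneg(1,2)[OF assms(1)] disjoint_nonneg(2)[OF assms(2)]]
    unfolding assms by simp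
  show "0 \<le> inf a (b + c)"
    using disjoint_nonneg[OF assms(1)] disjoint_nonneg[OF assms(2)] by simp
qed

lemma disjoint_scaleR:
  fixes a b :: "'a::vector_lattice"
  assumes "inf a b = 0" "0 \<le> t"
  shows "inf a (t *\<^sub>R b) = 0"
proof (rule antisym)
  note nn = disjoint_nonneg[OF assms(1)]
  \<comment> \<open>Dividing by \<open>s\<close> brings \<open>?y\<close> below \<open>a\<close>
    because \<open>s \<ge> 1\<close> and below \<open>b\<close> because
    \<open>s \<ge> t\<close>.\<close>
  define s where "s = max 1 t"
  have s: "s \<ge> 1" "s \<ge> t" by (auto simp: s_def)
  let ?y = "inf a (t *\<^sub>R b)"
  have y0: "0 \<le> ?y" using nn assms(2) by (simp add: scaleR_nonneg_nonneg)
  have "(1/s) *\<^sub>R ?y \<le> (1/s) *\<^sub>R (t *\<^sub>R b)"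
    using s by (intro scaleR_left_mono) auto
  also have "\<dots> \<le> 1 *\<^sub>R b"
    unfolding scaleR_scaleR using s nn by (intro scaleR_right_mono) (auto simp: field_simps)
  finally have "(1/s) *\<^sub>R ?y \<le> b" by simp
  moreover have "(1/s) *\<^sub>R ?y \<le> 1 *\<^sub>R ?y"
    using s y0 by (intro scaleR_right_mono) auto
  then have "(1/s) *\<^sub>R ?y \<le> a" by (rule order_trans) simp
  ultimately have "(1/s) *\<^sub>R ?y \<le> inf a b" by simp
  then have "s *\<^sub>R ((1/s) *\<^sub>R ?y) \<le> s *\<^sub>R 0"
    unfolding assms(1) using s by (intro scaleR_left_mono) auto
  then show "?y \<le> 0" using s by simp
  show "0 \<le> ?y" by (rule y0)
qed

lemma disjoint_add_le:
  fixes a b c :: "'a::vector_lattice"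
  assumes "inf a b = 0" "a \<le> c" "b \<le> c"
  shows "a + b \<le> c"
  using assms add_eq_inf_sup[of a b] by simp

text \<open>The disjoint elements \<open>\<bar>y\<bar>\<close> and \<open>\<bar>z\<bar>\<close> both
  lie below \<open>\<bar>y + z\<bar>\<close>, hence so does their sum. The bounds \<open>a\<close>
  and \<open>b\<close> carry the disjointness, which is the form in which a splitting provides
  it.\<close>

lemma abs_add_disjoint:
  fixes a b y z :: "'a::vector_lattice"
  assumes "inf a b = 0" "\<bar>y\<bar> \<le> a" "\<bar>z\<bar> \<le> b"
  shows "\<bar>y + z\<bar> = \<bar>y\<bar> + \<bar>z\<bar>"
proof (rule antisym)
  have *: "\<bar>u\<bar> \<le> \<bar>u + v\<bar>" if "inf \<bar>u\<bar> \<bar>v\<bar> = 0" for u v :: 'a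
  proof -
    have "\<bar>u\<bar> = inf \<bar>u\<bar> (\<bar>u + v\<bar> + \<bar>v\<bar>)"
      using abs_triangle_ineq4[of "u + v" v] by (simp add: inf_absorb1)
    also have "\<dots> \<le> inf \<bar>u\<bar> \<bar>u + v\<bar> + inf \<bar>u\<bar> \<bar>v\<bar>" by (rule inf_add_le) auto
    finally show ?thesis using that by (simp add: le_inf_iff)
  qed
  have d: "inf \<bar>y\<bar> \<bar>z\<bar> = 0" using assms by (auto intro: disjoint_mono)
  show "\<bar>y\<bar> + \<bar>z\<bar> \<le> \<bar>y + z\<bar>"
    using *[OF d] *[of z y] d
    by (intro disjoint_add_le) (auto simp: inf_commute add.commute)
qed (rule abs_triangle_ineq)

lemma pprt_disjoint:
  fixes x :: "'a::vector_lattice"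
  shows "inf (pprt x) (pprt (- x)) = 0"
proof -
  have "nprt x = x - pprt x" by (metis prts add_diff_cancel_left')
  then have "pprt (- x) = pprt x + (- x)" by (simp add: pprt_neg)
  then have "inf (pprt x) (pprt (- x)) = pprt x + inf 0 (- x)"
    by (simp add: add_inf_distrib_left)
  also have "inf 0 (- x) = nprt (- x)" by (simp add: nprt_def inf_commute)
  finally show ?thesis by (simp add: nprt_neg)
qed

lemma pprt_le_iff:
  fixes x :: "'a::vector_lattice"
  shows "pprt x \<le> y \<longleftrightarrow> x \<le> y \<and> 0 \<le> y"
  by (simp add: pprt_def)

text \<open>The inequality \<open>\<le>\<close> for all scalars yields the reverse one when applied
  to \<open>1/t\<close> and \<open>t *\<^sub>R x\<close>.\<close>

lemma abs_scaleR:
  fixes x :: "'a::vector_lattice"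
  shows "\<bar>t *\<^sub>R x\<bar> = \<bar>t\<bar> *\<^sub>R \<bar>x\<bar>"
proof -
  have le: "\<bar>t *\<^sub>R x\<bar> \<le> \<bar>t\<bar> *\<^sub>R \<bar>x\<bar>" for t and x :: 'a
  proof (rule abs_leI)
    have 1: "s *\<^sub>R y \<le> \<bar>s\<bar> *\<^sub>R \<bar>y\<bar>" for s and y :: 'a
    proof (cases "s \<ge> 0")
      case True
      then show ?thesis by (intro order_trans[OF scaleR_left_mono[OF abs_ge_self[of y]]]) auto
    next
      case False
      then have "(- s) *\<^sub>R (- y) \<le> (- s) *\<^sub>R \<bar>y\<bar>"
        by (intro scaleR_left_mono) (auto simp: abs_ge_minus_self)
      then show ?thesis using False by simp
    qed
    show "t *\<^sub>R x \<le> \<bar>t\<bar> *\<^sub>R \<bar>x\<bar>" by (rule 1)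
    show "- (t *\<^sub>R x) \<le> \<bar>t\<bar> *\<^sub>R \<bar>x\<bar>" using 1[of t "- x"] by simp
  qed
  show ?thesis
  proof (cases "t = 0")
    case False
    have "\<bar>t\<bar> *\<^sub>R \<bar>x\<bar> = \<bar>t\<bar> *\<^sub>R \<bar>(1/t) *\<^sub>R (t *\<^sub>R x)\<bar>" using False by simp
    also have "\<dots> \<le> \<bar>t\<bar> *\<^sub>R (\<bar>1/t\<bar> *\<^sub>R \<bar>t *\<^sub>R x\<bar>)"
      by (intro scaleR_left_mono le) auto
    also have "\<dots> = \<bar>t *\<^sub>R x\<bar>" using False by simp
    finally show ?thesis using le[of t x] by (intro antisym)
  qed simp
qed

subsection \<open>Lattice seminorms\<close>

lemma lattice_seminorm_abs_mono: "lattice_seminorm p \<Longrightarrow> \<bar>x\<bar> \<le> \<bar>y\<bar> \<Longrightarrow> p x \<le> p y"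
  by (simp add: lattice_seminorm_def)

lemma lattice_seminorm_triangle: "lattice_seminorm p \<Longrightarrow> p (x + y) \<le> p x + p y"
  by (simp add: lattice_seminorm_def)

lemma lattice_seminorm_scaleR: "lattice_seminorm p \<Longrightarrow> p (c *\<^sub>R x) = \<bar>c\<bar> * p x"
  by (simp add: lattice_seminorm_def)

lemma lattice_seminorm_minus: "lattice_seminorm p \<Longrightarrow> p (- x) = p x"
  using lattice_seminorm_scaleR[of p "-1" x] by simp

lemma lattice_seminorm_triangle_diff:
  assumes "lattice_seminorm p"
  shows "\<bar>p x - p y\<bar> \<le> p (x - y)"
proof -
  have "p x \<le> p (x - y) + p y" using lattice_seminorm_triangle[OF assms, of "x - y" y] by simp
  moreover have "p y \<le> p (y - x) + p x"
    using lattice_seminorm_triangle[OF assms, of "y - x" x] by simp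
  moreover have "p (y - x) = p (x - y)" using lattice_seminorm_minus[OF assms, of "x - y"] by simp
  ultimately show ?thesis by auto
qed

lemma lattice_seminorm_sum_le:
  assumes "lattice_seminorm p"
  shows "p (sum f F) \<le> (\<Sum>i\<in>F. p (f i))"
proof (induction F rule: infinite_finite_induct)
  case (insert i F)
  then show ?case using lattice_seminorm_triangle[OF assms, of "f i" "sum f F"] by simp
qed (simp_all add: lattice_seminorm_zero[OF assms])

lemma mnvl_seminorm: "mnvl M \<Longrightarrow> p \<in> M \<Longrightarrow> lattice_seminorm p"
  by (simp add: mnvl_def)

lemma mnvl_eq_0:
  assumes "mnvl M" "\<And>p e. p \<in> M \<Longrightarrow> 0 < e \<Longrightarrow> p x < e"
  shows "x = 0"
proof (rule ccontr)
  assume "x \<noteq> 0"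
  then obtain p where p: "p \<in> M" "p x \<noteq> 0" using assms(1) unfolding mnvl_def by blast
  then have "p x > 0" using lattice_seminorm_nonneg[OF mnvl_seminorm[OF assms(1) p(1)], of x] by simp
  then show False using assms(2)[OF p(1), of "p x"] by simp
qed

lemma mnvl_pos:
  assumes "mnvl M" "x \<noteq> 0"
  obtains p where "p \<in> M" "p x > 0"
proof -
  obtain p where p: "p \<in> M" "p x \<noteq> 0" using assms unfolding mnvl_def by blast
  then show thesis
    using that[of p] lattice_seminorm_nonneg[OF mnvl_seminorm[OF assms(1) p(1)], of x] by linarith
qed

text \<open>A separating family of lattice seminorms makes the space Archimedean:
  \<open>p (pprt x) \<le> e * p z\<close> for all \<open>e > 0\<close> forces
  \<open>pprt x = 0\<close>.\<close>

lemma mnvl_archimedean: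
  fixes M :: "('a::vector_lattice \<Rightarrow> real) set" and x z :: "'a::vector_lattice"
  assumes M: "mnvl M" and le: "\<And>e::real. e > 0 \<Longrightarrow> x \<le> e *\<^sub>R z"
  shows "x \<le> 0"
proof -
  have "pprt x = 0"
  proof (rule mnvl_eq_0[OF M])
    fix p and e :: real assume p: "p \<in> M" and e: "e > 0"
    note sn = mnvl_seminorm[OF M p]
    \<comment> \<open>The summand 1 covers the case \<open>p z = 0\<close>.\<close>
    define d where "d = e / (p z + 1)"
    have pz: "p z \<ge> 0" by (rule lattice_seminorm_nonneg[OF sn])
    have d: "d > 0" using e pz by (simp add: d_def)
    have "x \<le> \<bar>d *\<^sub>R z\<bar>" by (rule order_trans[OF le[OF d] abs_ge_self])
    then have "p (pprt x) \<le> p (d *\<^sub>R z)"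
      by (intro lattice_seminorm_abs_mono[OF sn]) (simp add: pprt_le_iff)
    also have "\<dots> = d * p z" using d by (simp add: lattice_seminorm_scaleR[OF sn])
    also have "\<dots> < e" using e pz by (simp add: d_def field_simps)
    finally show "p (pprt x) < e" .
  qed
  then show ?thesis by (simp add: le_zero_iff_zero_pprt)
qed

text \<open>A seminorm positive at \<open>e\<close> bounds the admissible multiples; by the
  Archimedean property their supremum is attained.\<close>

lemma mnvl_max_multiple:
  fixes M :: "('a::vector_lattice \<Rightarrow> real) set" and x e :: "'a::vector_lattice"
  assumes M: "mnvl M" and e: "0 < e" and x: "0 \<le> x"
  obtains t where "t \<ge> 0" "t *\<^sub>R e \<le> x" "\<And>s. s *\<^sub>R e \<le> x \<Longrightarrow> s \<le> t"
proof -
  obtain p where p: "p \<in> M" "p e > 0" using mnvl_pos[OF M, of e] e by auto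
  note sn = mnvl_seminorm[OF M p(1)]
  define S where "S = {s. s *\<^sub>R e \<le> x}"
  have "s \<le> p x / p e" if "s \<in> S" for s
  proof (cases "s \<ge> 0")
    case True
    then have "p (s *\<^sub>R e) \<le> p x"
      using that e by (intro lattice_seminorm_mono[OF sn]) (auto simp: S_def scaleR_nonneg_nonneg)
    then show ?thesis using True p by (simp add: lattice_seminorm_scaleR[OF sn] field_simps)
  next
    case False
    then have "s \<le> 0" by simp
    also have "0 \<le> p x / p e" using p lattice_seminorm_nonneg[OF sn] by simp
    finally show ?thesis .
  qed
  then have bdd: "bdd_above S" by (rule bdd_aboveI)
  have S0: "0 \<in> S" using x by (simp add: S_def)
  define t where "t = Sup S"
  have ub: "s \<le> t" if "s \<in> S" for s using that bdd by (simp add: t_def cSup_upper)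
  have "t *\<^sub>R e - x \<le> 0"
  proof (rule mnvl_archimedean[OF M])
    fix d :: real assume "d > 0"
    then obtain s where s: "s \<in> S" "t - d < s"
      using less_cSupD[of S "t - d"] S0 by (auto simp: t_def)
    have "t *\<^sub>R e = (t - s) *\<^sub>R e + s *\<^sub>R e" by (simp add: algebra_simps)
    also have "\<dots> \<le> d *\<^sub>R e + x"
      using s e by (intro add_mono scaleR_right_mono) (auto simp: S_def)
    finally show "t *\<^sub>R e - x \<le> d *\<^sub>R e" by (simp add: algebra_simps)
  qed
  then show thesis using that[of t] ub S0 by (auto simp: S_def)
qed

subsection \<open>Coordinates with respect to an atom\<close>

lemma atom_multiple:
  fixes e y :: "'a::vector_lattice"
  assumes "atom e" "\<bar>y\<bar> \<le> \<bar>s *\<^sub>R e\<bar>"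
  obtains k where "y = k *\<^sub>R e"
proof -
  have "y \<in> order_ideal hull {e}"
    unfolding hull_def
  proof safe
    fix J :: "'a set" assume J: "order_ideal J" "{e} \<subseteq> J"
    then have "s *\<^sub>R e \<in> J" by (simp add: order_ideal_def subspace_scale)
    then show "y \<in> J" using J(1) assms(2) unfolding order_ideal_def by blast
  qed
  then show thesis using assms(1) that by (auto simp: atom_def span_singleton)
qed

lemma atom_pos: "atom e \<Longrightarrow> 0 < e"
  by (simp add: atom_def)

text \<open>For an atom \<open>e\<close>, this is the coefficient of the band projection of
  \<open>x\<close> onto the line through \<open>e\<close>, expressed by disjointness of the residual
  from \<open>e\<close>. Existence and uniqueness are \<open>coord_residual_disjoint\<close> and
  \<open>coord_unique\<close>.\<close>

definition coord :: "'a::vector_lattice \<Rightarrow> 'a \<Rightarrow> real" where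
  "coord e x = (THE t. inf \<bar>x - t *\<^sub>R e\<bar> e = 0)"

context
  fixes M :: "('a::vector_lattice \<Rightarrow> real) set" and e :: 'a
  assumes M: "mnvl M" and e: "atom e"
begin

text \<open>Take the largest multiple \<open>t\<close> of \<open>e\<close> below \<open>x\<close>.
  The meet of the remainder with \<open>e\<close> lies in the ideal of the atom, so it is
  \<open>k *\<^sub>R e\<close> for some \<open>k\<close>, and \<open>k > 0\<close> would contradict
  maximality.\<close>

lemma atom_decompose_nonneg:
  assumes x: "0 \<le> x"
  obtains t where "0 \<le> t" "t *\<^sub>R e \<le> x" "inf (x - t *\<^sub>R e) e = 0"
proof -
  note e0 = atom_pos[OF e]
  obtain t where t: "t \<ge> 0" "t *\<^sub>R e \<le> x" "\<And>s. s *\<^sub>R e \<le> x \<Longrightarrow> s \<le> t"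
    using mnvl_max_multiple[OF M e0 x] by blast
  define y where "y = inf (x - t *\<^sub>R e) e"
  have y: "0 \<le> y" "y \<le> e" "y \<le> x - t *\<^sub>R e" using t e0 by (auto simp: y_def)
  have "\<bar>y\<bar> \<le> \<bar>1 *\<^sub>R e\<bar>" using y e0 by simp
  then obtain k where k: "y = k *\<^sub>R e" using atom_multiple[OF e] by blast
  have "(t + k) *\<^sub>R e \<le> x" using y(3) unfolding k by (simp add: algebra_simps)
  then have "k \<le> 0" using t(3) by force
  then have "k *\<^sub>R e \<le> 0 *\<^sub>R e" using e0 by (intro scaleR_right_mono) auto
  then have "y = 0" using y(1) k by simp
  then show thesis using that t unfolding y_def by blast
qed

text \<open>If \<open>t \<noteq> s\<close>, the two residuals together dominate a positive multiple
  of \<open>e\<close>, so \<open>e\<close> would be disjoint from itself.\<close>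

lemma coord_unique:
  assumes "inf \<bar>x - t *\<^sub>R e\<bar> e = 0" "inf \<bar>x - s *\<^sub>R e\<bar> e = 0"
  shows "t = s"
proof (rule ccontr)
  assume ts: "t \<noteq> s"
  note e = atom_pos[OF e]
  have d: "inf e (\<bar>x - t *\<^sub>R e\<bar> + \<bar>x - s *\<^sub>R e\<bar>) = 0"
    using assms by (intro disjoint_add) (simp_all add: inf_commute)
  have "\<bar>t - s\<bar> *\<^sub>R e = \<bar>(t - s) *\<^sub>R e\<bar>" using e by (simp add: abs_scaleR)
  also have "(t - s) *\<^sub>R e = (x - s *\<^sub>R e) - (x - t *\<^sub>R e)" by (simp add: algebra_simps)
  also have "\<bar>\<dots>\<bar> \<le> \<bar>x - t *\<^sub>R e\<bar> + \<bar>x - s *\<^sub>R e\<bar>"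
    using abs_triangle_ineq4[of "x - s *\<^sub>R e" "x - t *\<^sub>R e"] by (simp add: add.commute)
  finally have "inf e (\<bar>t - s\<bar> *\<^sub>R e) = 0"
    using e by (intro disjoint_mono[OF d]) (auto simp: scaleR_nonneg_nonneg)
  then have "inf e ((1/\<bar>t - s\<bar>) *\<^sub>R (\<bar>t - s\<bar> *\<^sub>R e)) = 0" by (rule disjoint_scaleR) simp
  then show False using ts e by simp
qed

lemma coord_eqI:
  assumes "inf \<bar>x - t *\<^sub>R e\<bar> e = 0"
  shows "coord e x = t"
  unfolding coord_def using assms coord_unique by (intro the_equality) auto

lemma coord_residual_disjoint:
  "inf \<bar>x - coord e x *\<^sub>R e\<bar> e = 0"
proof -
  note e0 = atom_pos[OF e]
  obtain s where s: "s *\<^sub>R e \<le> pprt x" "inf (pprt x - s *\<^sub>R e) e = 0"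
    using atom_decompose_nonneg[OF zero_le_pprt[of x]] by blast
  obtain t where t: "t *\<^sub>R e \<le> pprt (- x)" "inf (pprt (- x) - t *\<^sub>R e) e = 0"
    using atom_decompose_nonneg[OF zero_le_pprt[of "- x"]] by blast
  have d: "inf e ((pprt x - s *\<^sub>R e) + (pprt (- x) - t *\<^sub>R e)) = 0"
    using s t by (intro disjoint_add) (simp_all add: inf_commute)
  have "x - (s - t) *\<^sub>R e = (pprt x + nprt x) - (s - t) *\<^sub>R e" by (simp flip: prts)
  also have "\<dots> = (pprt x - s *\<^sub>R e) - (pprt (- x) - t *\<^sub>R e)"
    by (simp add: pprt_neg algebra_simps)
  finally have "\<bar>x - (s - t) *\<^sub>R e\<bar> \<le> (pprt x - s *\<^sub>R e) + (pprt (- x) - t *\<^sub>R e)"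
    using abs_triangle_ineq4[of "pprt x - s *\<^sub>R e" "pprt (- x) - t *\<^sub>R e"] s t by simp
  then have "inf e \<bar>x - (s - t) *\<^sub>R e\<bar> = 0"
    using e0 by (intro disjoint_mono[OF d]) auto
  then have *: "inf \<bar>x - (s - t) *\<^sub>R e\<bar> e = 0" by (simp add: inf_commute)
  then show ?thesis using coord_eqI[OF *] by simp
qed

lemma coord_add:
  "coord e (x + y) = coord e x + coord e y"
proof (rule coord_eqI)
  note e0 = atom_pos[OF e]
  have d: "inf e (\<bar>x - coord e x *\<^sub>R e\<bar> + \<bar>y - coord e y *\<^sub>R e\<bar>) = 0"
    using coord_residual_disjoint by (intro disjoint_add) (simp_all add: inf_commute)
  have "x + y - (coord e x + coord e y) *\<^sub>R e = (x - coord e x *\<^sub>R e) + (y - coord e y *\<^sub>R e)"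
    by (simp add: algebra_simps)
  then have "\<bar>x + y - (coord e x + coord e y) *\<^sub>R e\<bar> \<le> \<bar>x - coord e x *\<^sub>R e\<bar> + \<bar>y - coord e y *\<^sub>R e\<bar>"
    by (metis abs_triangle_ineq)
  then have "inf e \<bar>x + y - (coord e x + coord e y) *\<^sub>R e\<bar> = 0"
    using e0 by (intro disjoint_mono[OF d]) auto
  then show "inf \<bar>x + y - (coord e x + coord e y) *\<^sub>R e\<bar> e = 0" by (simp add: inf_commute)
qed

lemma coord_scaleR_atom:
  "coord e (t *\<^sub>R e) = t"
  using atom_pos[OF e] by (intro coord_eqI) (auto simp: inf_absorb1)

lemma coord_disjoint:
  assumes "inf \<bar>x\<bar> e = 0"
  shows "coord e x = 0"
  using assms by (intro coord_eqI) simp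

lemma coord_zero: "coord e 0 = 0"
  using coord_scaleR_atom[of 0] by simp

lemma coord_diff:
  "coord e (x - y) = coord e x - coord e y"
  using coord_add[of "x - y" y] by simp

lemma coord_sum:
  "coord e (sum g F) = (\<Sum>i\<in>F. coord e (g i))"
  by (induction F rule: infinite_finite_induct) (auto simp: coord_zero coord_add)

lemma coord_abs:
  "coord e \<bar>x\<bar> = \<bar>coord e x\<bar>"
proof (rule coord_eqI)
  note e0 = atom_pos[OF e]
  have "\<bar>\<bar>x\<bar> - \<bar>coord e x\<bar> *\<^sub>R e\<bar> = \<bar>\<bar>x\<bar> - \<bar>coord e x *\<^sub>R e\<bar>\<bar>"
    using e0 by (simp add: abs_scaleR)
  also have "\<dots> \<le> \<bar>x - coord e x *\<^sub>R e\<bar>" by (rule abs_triangle_ineq3)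
  finally show "inf \<bar>\<bar>x\<bar> - \<bar>coord e x\<bar> *\<^sub>R e\<bar> e = 0"
    using e0 by (intro disjoint_mono[OF coord_residual_disjoint[of x]]) auto
qed

lemma coord_nonneg_le:
  assumes x: "0 \<le> x"
  shows "0 \<le> coord e x" "coord e x *\<^sub>R e \<le> x"
proof -
  note e0 = atom_pos[OF e]
  obtain t where t: "0 \<le> t" "t *\<^sub>R e \<le> x" "inf (x - t *\<^sub>R e) e = 0"
    using atom_decompose_nonneg[OF x] by blast
  then have "coord e x = t" by (intro coord_eqI) simp
  then show "0 \<le> coord e x" "coord e x *\<^sub>R e \<le> x" using t by auto
qed

lemma coord_mono:
  assumes "x \<le> y"
  shows "coord e x \<le> coord e y"
  using coord_nonneg_le(1)[of "y - x"] assms by (simp add: coord_diff)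

end

subsection \<open>Coordinates with respect to a system of atoms\<close>

definition atom_sum :: "'a::vector_lattice set \<Rightarrow> ('a \<Rightarrow> real) \<Rightarrow> 'a" where
  "atom_sum F c = (\<Sum>e\<in>F. c e *\<^sub>R e)"

abbreviation proj :: "'a::vector_lattice set \<Rightarrow> 'a \<Rightarrow> 'a" where
  "proj F x \<equiv> atom_sum F (\<lambda>e. coord e x)"

locale atom_system =
  fixes M :: "('a::vector_lattice \<Rightarrow> real) set" and E :: "'a set"
  assumes M: "mnvl M"
    and atoms: "\<And>e. e \<in> E \<Longrightarrow> atom e"
    and pw: "pairwise (\<lambda>e f. inf e f = 0) E"
    and total: "\<And>x. 0 \<le> x \<Longrightarrow> (\<And>e. e \<in> E \<Longrightarrow> inf x e = 0) \<Longrightarrow> x = 0"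
begin

lemma atoms_pos: "e \<in> E \<Longrightarrow> 0 < e"
  using atoms atom_pos by blast

lemma coord_scaleR_other:
  assumes "e \<in> E" "f \<in> E" "e \<noteq> f"
  shows "coord e (t *\<^sub>R f) = 0"
proof (rule coord_disjoint[OF M atoms[OF assms(1)]])
  have "inf e f = 0" using pw assms by (auto simp: pairwise_def)
  then have "inf e (\<bar>t\<bar> *\<^sub>R f) = 0" by (rule disjoint_scaleR) simp
  then show "inf \<bar>t *\<^sub>R f\<bar> e = 0" using atoms_pos[OF assms(2)] by (simp add: abs_scaleR inf_commute)
qed

lemma coord_atom_sum:
  assumes "e \<in> E" "finite F" "F \<subseteq> E"
  shows "coord e (atom_sum F c) = (if e \<in> F then c e else 0)"
proof -
  have "coord e (atom_sum F c) = (\<Sum>f\<in>F. coord e (c f *\<^sub>R f))"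
    unfolding atom_sum_def by (rule coord_sum[OF M atoms[OF assms(1)]])
  also have "\<dots> = (\<Sum>f\<in>F. if f = e then c e else 0)"
    using assms coord_scaleR_atom[OF M atoms[OF assms(1)]] coord_scaleR_other
    by (intro sum.cong) auto
  finally show ?thesis using assms(2) by simp
qed

text \<open>Injectivity of the coordinate map: when all coordinates vanish, the residuals are
  \<open>x\<close> itself, so \<open>\<bar>x\<bar>\<close> is disjoint from all of
  \<open>E\<close>.\<close>

lemma coord_eq_0_imp:
  assumes "\<And>e. e \<in> E \<Longrightarrow> coord e x = 0"
  shows "x = 0"
proof -
  have "\<bar>x\<bar> = 0"
  proof (rule total)
    fix e assume e: "e \<in> E"
    then show "inf \<bar>x\<bar> e = 0"
      using coord_residual_disjoint[OF M atoms[OF e], of x] assms by simp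
  qed simp
  then show ?thesis by simp
qed

text \<open>Atoms are removed one at a time: subtracting \<open>proj F x\<close> does not change the
  coordinate at a new \<open>e\<close>, so \<open>coord_nonneg_le\<close> applies to the
  remainder.\<close>

lemma proj_le:
  assumes "0 \<le> x" "finite F" "F \<subseteq> E"
  shows "proj F x \<le> x"
  using assms(2,3)
proof (induction F)
  case empty
  then show ?case using assms(1) by (simp add: atom_sum_def)
next
  case (insert e F)
  then have e: "atom e" "e \<in> E" using atoms by auto
  have "coord e (x - proj F x) *\<^sub>R e \<le> x - proj F x"
    using insert by (intro coord_nonneg_le[OF M e(1)]) auto
  also have "coord e (x - proj F x) = coord e x"
    using insert coord_atom_sum[OF e(2), of F] by (simp add: coord_diff[OF M e(1)])
  finally show ?case using insert by (simp add: atom_sum_def algebra_simps)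
qed

lemma proj_diff:
  assumes "F \<subseteq> E"
  shows "proj F (x - y) = proj F x - proj F y"
proof -
  have "proj F (x - y) = (\<Sum>e\<in>F. coord e x *\<^sub>R e - coord e y *\<^sub>R e)"
    unfolding atom_sum_def using assms atoms
    by (intro sum.cong refl) (auto simp: coord_diff[OF M] scaleR_diff_left)
  then show ?thesis by (simp add: atom_sum_def sum_subtractf)
qed

lemma atom_sum_mono:
  assumes "finite G" "F \<subseteq> G" "G \<subseteq> E" "\<And>e. e \<in> E \<Longrightarrow> 0 \<le> c e"
  shows "atom_sum F c \<le> atom_sum G c"
  unfolding atom_sum_def using assms atoms_pos
  by (intro sum_mono2) (auto intro!: scaleR_nonneg_nonneg simp: less_imp_le)

lemma proj_tail_mono:
  assumes "v \<le> u" "finite F" "F \<subseteq> E"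
  shows "v - proj F v \<le> u - proj F u"
  using proj_le[of "u - v" F] assms by (simp add: proj_diff algebra_simps)

section \<open>Remainders after projection onto finitely many atoms\<close>

lemma directed_finite_subsets: "directed_index {F. finite F \<and> F \<subseteq> E} (\<subseteq>)"
  unfolding directed_index_def
proof (intro conjI ballI)
  fix F G assume "F \<in> {F. finite F \<and> F \<subseteq> E}" "G \<in> {F. finite F \<and> F \<subseteq> E}"
  then show "\<exists>H\<in>{F. finite F \<and> F \<subseteq> E}. F \<subseteq> H \<and> G \<subseteq> H"
    by (intro bexI[of _ "F \<union> G"]) auto
qed (auto simp: reflp_on_def transp_on_def)

lemma proj_tail_decreases:
  assumes x: "0 \<le> x"
  shows "decreases_to {F. finite F \<and> F \<subseteq> E} (\<subseteq>) (\<lambda>F. x - proj F x) 0"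
  unfolding decreases_to_def
proof
  show "monotone_on {F. finite F \<and> F \<subseteq> E} (\<subseteq>) (\<ge>) (\<lambda>F. x - proj F x)"
    using atom_sum_mono coord_nonneg_le(1)[OF M atoms x]
    by (auto simp: monotone_on_def intro!: diff_left_mono)
  show "isGlb UNIV ((\<lambda>F. x - proj F x) ` {F. finite F \<and> F \<subseteq> E}) 0"
  proof (rule isGlbI2)
    show "isLb UNIV ((\<lambda>F. x - proj F x) ` {F. finite F \<and> F \<subseteq> E}) 0"
      using proj_le[OF x] by (auto simp: isLb_def setge_def)
    show "Collect (isLb UNIV ((\<lambda>F. x - proj F x) ` {F. finite F \<and> F \<subseteq> E})) *<= 0"
      unfolding setle_def
    proof
      fix z assume "z \<in> Collect (isLb UNIV ((\<lambda>F. x - proj F x) ` {F. finite F \<and> F \<subseteq> E}))"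
      then have z: "z \<le> x - proj F x" if "finite F" "F \<subseteq> E" for F
        using that by (auto simp: isLb_def setge_def)
      \<comment> \<open>Singletons suffice: the remainder \<open>x - proj {e} x\<close> has
        coordinate 0 at \<open>e\<close>, and it dominates \<open>pprt z\<close>.\<close>
      have "pprt z = 0"
      proof (rule coord_eq_0_imp)
        fix e assume e: "e \<in> E"
        note a = atoms[OF e]
        have "pprt z \<le> x - proj {e} x"
          using z[of "{e}"] proj_le[OF x, of "{e}"] e by (simp add: pprt_le_iff)
        then have "coord e (pprt z) \<le> coord e (x - proj {e} x)" by (rule coord_mono[OF M a])
        also have "\<dots> = 0" using e by (simp add: coord_diff[OF M a] coord_atom_sum)
        finally show "coord e (pprt z) = 0"
          using coord_nonneg_le(1)[OF M a, of "pprt z"] by simp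
      qed
      then show "z \<le> 0" by (simp add: le_zero_iff_zero_pprt)
    qed
  qed
qed

lemma proj_tail_small:
  assumes "lebesgue_property M" "0 \<le> x" "p \<in> M" "0 < \<epsilon>"
  obtains F where "finite F" "F \<subseteq> E" "p (x - proj F x) < \<epsilon>"
proof -
  have "m_converges M {F. finite F \<and> F \<subseteq> E} (\<subseteq>) (\<lambda>F. x - proj F x) 0"
    by (rule lebesgue_property_net[OF assms(1) directed_finite_subsets proj_tail_decreases[OF assms(2)]])
  then show thesis using assms(3,4) that unfolding m_converges_def by force
qed

text \<open>The first term tends to zero with finitely many coordinates of \<open>y\<close>; the second does not
  depend on \<open>y\<close> and is small for large \<open>F\<close> under the Lebesgue property.\<close>

lemma inf_abs_le_coords:
  assumes p: "lattice_seminorm p" and u: "0 \<le> u" and F: "finite F" "F \<subseteq> E"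
  shows "p (inf \<bar>y\<bar> u) \<le> (\<Sum>e\<in>F. \<bar>coord e y\<bar> * p e) + p (u - proj F u)"
proof -
  define v where "v = inf \<bar>y\<bar> u"
  have v: "0 \<le> v" "v \<le> \<bar>y\<bar>" "v \<le> u" using u by (auto simp: v_def)
  have "p v \<le> p (proj F v) + p (v - proj F v)"
    using lattice_seminorm_triangle[OF p, of "proj F v" "v - proj F v"] by simp
  also have "p (v - proj F v) \<le> p (u - proj F u)"
    using proj_le[OF v(1) F] proj_tail_mono[OF v(3) F] by (intro lattice_seminorm_mono[OF p]) auto
  also have "p (proj F v) \<le> (\<Sum>e\<in>F. p (coord e v *\<^sub>R e))"
    unfolding atom_sum_def by (rule lattice_seminorm_sum_le[OF p])
  also have "\<dots> \<le> (\<Sum>e\<in>F. \<bar>coord e y\<bar> * p e)"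
  proof (rule sum_mono)
    fix e assume "e \<in> F"
    then have e: "atom e" using F atoms by auto
    have "\<bar>coord e v\<bar> \<le> \<bar>coord e y\<bar>"
      using coord_mono[OF M e v(2)] coord_nonneg_le(1)[OF M e v(1)] by (simp add: coord_abs[OF M e])
    then show "p (coord e v *\<^sub>R e) \<le> \<bar>coord e y\<bar> * p e"
      using lattice_seminorm_nonneg[OF p]
      by (simp add: lattice_seminorm_scaleR[OF p] mult_right_mono)
  qed
  finally show ?thesis by (simp add: v_def)
qed

text \<open>The element is the supremum \<open>l\<close> of the finite partial sums. A coordinate of
  \<open>l\<close> cannot be too large at \<open>e\<close>: after subtraction of the excess multiple
  of \<open>e\<close>, \<open>l\<close> would still be an upper bound.\<close>

lemma levi_coord_exists_nonneg:
  assumes levi: "levi_property M" and d: "\<And>e. e \<in> E \<Longrightarrow> 0 \<le> d e"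
    and bound: "\<And>p F. p \<in> M \<Longrightarrow> finite F \<Longrightarrow> F \<subseteq> E \<Longrightarrow> p (atom_sum F d) \<le> C p"
  obtains l where "\<And>e. e \<in> E \<Longrightarrow> coord e l = d e"
proof -
  let ?I = "{F. finite F \<and> F \<subseteq> E}"
  have mono: "atom_sum F d \<le> atom_sum G d" if "finite G" "F \<subseteq> G" "G \<subseteq> E" for F G
    using atom_sum_mono[of G F d] that d by blast
  have nn: "0 \<le> atom_sum F d" if "finite F" "F \<subseteq> E" for F
    using mono[of F "{}"] that by (simp add: atom_sum_def)
  have "\<exists>l. increases_to ?I (\<subseteq>) (\<lambda>F. atom_sum F d) l"
    using bound nn mono
    by (intro levi_property_net[OF levi directed_finite_subsets])
      (auto simp: monotone_on_def m_bounded_def bdd_above_def)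
  then obtain l where l: "isLub UNIV ((\<lambda>F. atom_sum F d) ` ?I) l"
    by (auto simp: increases_to_def)
  have ub: "atom_sum F d \<le> l" if "finite F" "F \<subseteq> E" for F
    using isLubD2[OF l] that by blast
  have lub: "l \<le> z" if "\<And>F. finite F \<Longrightarrow> F \<subseteq> E \<Longrightarrow> atom_sum F d \<le> z" for z
    using isLub_le_isUb[OF l, of z] that by (auto simp: isUb_def setle_def)
  have "coord e l = d e" if e: "e \<in> E" for e
  proof (rule antisym)
    note a = atoms[OF e]
    have "d e *\<^sub>R e \<le> l" using ub[of "{e}"] e by (simp add: atom_sum_def)
    then show le: "d e \<le> coord e l"
      using coord_mono[OF M a, of "d e *\<^sub>R e" l] by (simp add: coord_scaleR_atom[OF M a])
    have "l \<le> l - (coord e l - d e) *\<^sub>R e"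
    proof (rule lub)
      fix F assume F: "finite F" "F \<subseteq> E"
      \<comment> \<open>With \<open>e\<close> included, the coordinate of
        \<open>l - atom_sum G d\<close> at \<open>e\<close> is exactly the excess
        \<open>coord e l - d e\<close>.\<close>
      define G where "G = insert e F"
      have G: "finite G" "F \<subseteq> G" "G \<subseteq> E" "e \<in> G" using F e by (auto simp: G_def)
      have "coord e (l - atom_sum G d) *\<^sub>R e \<le> l - atom_sum G d"
        using ub G by (intro coord_nonneg_le[OF M a]) auto
      then have "(coord e l - d e) *\<^sub>R e \<le> l - atom_sum G d"
        using G e by (simp add: coord_diff[OF M a] coord_atom_sum)
      then show "atom_sum F d \<le> l - (coord e l - d e) *\<^sub>R e"
        using mono[OF G(1-3)] by (metis diff_le_eq le_diff_eq add.commute order_trans)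
    qed
    then have "coord e l \<le> coord e (l - (coord e l - d e) *\<^sub>R e)" by (rule coord_mono[OF M a])
    then show "coord e l \<le> d e" by (simp add: coord_diff[OF M a] coord_scaleR_atom[OF M a])
  qed
  then show thesis by (rule that)
qed

text \<open>The Levi property concerns nonnegative increasing nets, so the positive and negative
  parts of \<open>c\<close> are realised separately (\<open>s = 1\<close> and
  \<open>s = -1\<close>). Up to sign, a partial sum of either part is a partial sum of
  \<open>c\<close> over fewer atoms, so the bounds \<open>C\<close> are inherited.\<close>

lemma levi_coord_exists:
  assumes levi: "levi_property M"
    and bound: "\<And>p F. p \<in> M \<Longrightarrow> finite F \<Longrightarrow> F \<subseteq> E \<Longrightarrow> p (atom_sum F c) \<le> C p"
  obtains l where "\<And>e. e \<in> E \<Longrightarrow> coord e l = c e"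
proof -
  have part: "atom_sum F (\<lambda>e. max 0 (s * c e)) = s *\<^sub>R atom_sum {e\<in>F. s * c e > 0} c"
    if "finite F" for F s
    unfolding atom_sum_def scaleR_sum_right using that
    by (intro sum.mono_neutral_cong_right) (auto simp: max_def not_less order.strict_iff_order)
  have ex: "\<exists>l. \<forall>e\<in>E. coord e l = max 0 (s * c e)" if s: "\<bar>s\<bar> = 1" for s
  proof -
    obtain l where "\<And>e. e \<in> E \<Longrightarrow> coord e l = max 0 (s * c e)"
    proof (rule levi_coord_exists_nonneg[OF levi])
      fix p F assume p: "p \<in> M" and F: "finite F" "F \<subseteq> E"
      show "p (atom_sum F (\<lambda>e. max 0 (s * c e))) \<le> C p"
        using bound[OF p, of "{e\<in>F. s * c e > 0}"] F s
        by (subst part) (auto simp: lattice_seminorm_scaleR[OF mnvl_seminorm[OF M p]])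
    qed auto
    then show ?thesis by blast
  qed
  obtain l where l: "\<forall>e\<in>E. coord e l = max 0 (1 * c e)" using ex[of 1] by auto
  obtain k where k: "\<forall>e\<in>E. coord e k = max 0 (-1 * c e)" using ex[of "-1"] by auto
  have "coord e (l - k) = c e" if "e \<in> E" for e
    using that l k by (simp add: coord_diff[OF M atoms])
  then show thesis by (rule that)
qed

end

subsection \<open>Compactness in the presence of atoms\<close>

context atom_system
begin

abbreviation coord_space :: "('a \<Rightarrow> real) topology" where
  "coord_space \<equiv> product_topology (\<lambda>_. euclideanreal) E"

text \<open>Each condition involves finitely many coordinates only, hence is closed in the product
  topology; together they are the hypothesis of \<open>levi_coord_exists\<close>.\<close>

definition coord_box :: "(('a \<Rightarrow> real) \<Rightarrow> real) \<Rightarrow> ('a \<Rightarrow> real) set" where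
  "coord_box C = {c \<in> \<Pi>\<^sub>E e\<in>E. UNIV. \<forall>F p. finite F \<and> F \<subseteq> E \<and> p \<in> M \<longrightarrow> p (atom_sum F c) \<le> C p}"

lemma coord_box_bounded:
  assumes "c \<in> coord_box C" "e \<in> E" "p \<in> M" "0 < p e"
  shows "\<bar>c e\<bar> \<le> C p / p e"
proof -
  have "p (atom_sum {e} c) \<le> C p" using assms unfolding coord_box_def by blast
  then have "\<bar>c e\<bar> * p e \<le> C p"
    using mnvl_seminorm[OF M assms(3)] by (simp add: atom_sum_def lattice_seminorm_scaleR)
  then show ?thesis using assms(4) by (simp add: field_simps)
qed

lemma tendsto_coord_space:
  assumes "e \<in> E" "c \<in> topspace (subtopology coord_space K)"
  shows "((\<lambda>b. b e) \<longlongrightarrow> c e) (atin (subtopology coord_space K) c)"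
proof -
  have "continuous_map (subtopology coord_space K) euclideanreal (\<lambda>b. b e)"
    using assms(1) by (intro continuous_map_from_subtopology continuous_map_product_projection)
  then show ?thesis using assms(2) by (simp add: continuous_map_atin)
qed

lemma tendsto_weighted_sum:
  assumes "F \<subseteq> E" "c \<in> topspace (subtopology coord_space K)"
  shows "((\<lambda>b. \<Sum>e\<in>F. \<bar>b e - c e\<bar> * w e) \<longlongrightarrow> 0) (atin (subtopology coord_space K) c)"
proof -
  have "((\<lambda>b. \<Sum>e\<in>F. \<bar>b e - c e\<bar> * w e) \<longlongrightarrow> (\<Sum>e\<in>F. \<bar>c e - c e\<bar> * w e))
      (atin (subtopology coord_space K) c)"
    using assms by (intro tendsto_intros tendsto_coord_space) auto
  then show ?thesis by simp
qed

lemma continuous_map_seminorm_atom_sum: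
  assumes p: "lattice_seminorm p" and F: "F \<subseteq> E"
  shows "continuous_map coord_space euclideanreal (\<lambda>c. p (atom_sum F c))"
  unfolding continuous_map_atin
proof
  fix c assume c: "c \<in> topspace coord_space"
  have *: "\<bar>p (atom_sum F b) - p (atom_sum F c)\<bar> \<le> (\<Sum>e\<in>F. \<bar>b e - c e\<bar> * p e)" for b
  proof -
    have "\<bar>p (atom_sum F b) - p (atom_sum F c)\<bar> \<le> p (atom_sum F b - atom_sum F c)"
      by (rule lattice_seminorm_triangle_diff[OF p])
    also have "atom_sum F b - atom_sum F c = (\<Sum>e\<in>F. (b e - c e) *\<^sub>R e)"
      by (simp add: atom_sum_def sum_subtractf scaleR_diff_left)
    also have "p \<dots> \<le> (\<Sum>e\<in>F. p ((b e - c e) *\<^sub>R e))" by (rule lattice_seminorm_sum_le[OF p])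
    finally show ?thesis by (simp add: lattice_seminorm_scaleR[OF p])
  qed
  have "((\<lambda>b. \<Sum>e\<in>F. \<bar>b e - c e\<bar> * p e) \<longlongrightarrow> 0) (atin coord_space c)"
    using tendsto_weighted_sum[OF F, of c UNIV p] c by (simp only: subtopology_UNIV)
  then have "((\<lambda>b. p (atom_sum F b) - p (atom_sum F c)) \<longlongrightarrow> 0) (atin coord_space c)"
    by (rule Lim_null_comparison[rotated]) (simp add: *)
  then have "((\<lambda>b. p (atom_sum F b)) \<longlongrightarrow> p (atom_sum F c)) (atin coord_space c)"
    by (rule LIM_zero_cancel)
  then show "limitin euclideanreal (\<lambda>c. p (atom_sum F c)) (p (atom_sum F c)) (atin coord_space c)"
    by (simp only: limitin_canonical_iff)
qed

lemma compactin_coord_box: "compactin coord_space (coord_box C)"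
proof -
  \<comment> \<open>A seminorm that is positive at the atom \<open>e\<close> confines the coordinate
    at \<open>e\<close> to a compact interval.\<close>
  have "\<exists>q\<in>M. 0 < q e" if "e \<in> E" for e
    using mnvl_pos[OF M, of e] atoms_pos[OF that] by auto
  then have "\<forall>e\<in>E. \<exists>q. q \<in> M \<and> 0 < q e" by blast
  then obtain q where q: "\<And>e. e \<in> E \<Longrightarrow> q e \<in> M \<and> 0 < q e e"
    using bchoice[of E "\<lambda>e q. q \<in> M \<and> 0 < q e"] by blast
  define R where "R e = C (q e) / q e e" for e
  have "compactin coord_space (\<Pi>\<^sub>E e\<in>E. {- R e..R e})"
    by (simp add: compactin_PiE)
  moreover have "coord_box C \<subseteq> (\<Pi>\<^sub>E e\<in>E. {- R e..R e})"
  proof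
    fix c assume c: "c \<in> coord_box C"
    have "\<bar>c e\<bar> \<le> R e" if "e \<in> E" for e
      unfolding R_def using q[OF that] that c by (intro coord_box_bounded) auto
    then have "c e \<in> {- R e..R e}" if "e \<in> E" for e using that by (auto simp: abs_le_iff minus_le_iff)
    then show "c \<in> (\<Pi>\<^sub>E e\<in>E. {- R e..R e})" using c by (auto simp: coord_box_def PiE_iff)
  qed
  moreover have "closedin coord_space (coord_box C)"
  proof -
    have "closedin coord_space {c \<in> topspace coord_space. p (atom_sum F c) \<in> {..C p}}"
      if "p \<in> M" "F \<subseteq> E" for F p
      using mnvl_seminorm[OF M that(1)] that(2)
      by (intro closedin_continuous_map_preimage[OF continuous_map_seminorm_atom_sum]) auto
    then have "closedin coord_space (\<Inter>(insert (topspace coord_space)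
        {{c \<in> topspace coord_space. p (atom_sum F c) \<in> {..C p}} | F p. finite F \<and> F \<subseteq> E \<and> p \<in> M}))"
      using closedin_topspace[of coord_space] by (intro closedin_Inter) blast+
    moreover have "coord_box C = \<Inter>(insert (topspace coord_space)
        {{c \<in> topspace coord_space. p (atom_sum F c) \<in> {..C p}} | F p. finite F \<and> F \<subseteq> E \<and> p \<in> M})"
      by (auto simp: coord_box_def)
    ultimately show ?thesis by simp
  qed
  ultimately show ?thesis by (rule closed_compactin)
qed

text \<open>Keeping finitely many coordinates does not increase the modulus: \<open>\<bar>proj F
  x\<bar> \<le> proj F \<bar>x\<bar> \<le> \<bar>x\<bar>\<close>.\<close>

lemma coord_in_coord_box:
  assumes "\<And>p. p \<in> M \<Longrightarrow> p x \<le> C p"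
  shows "restrict (\<lambda>e. coord e x) E \<in> coord_box C"
  unfolding coord_box_def
proof (intro CollectI conjI allI impI)
  fix F p assume *: "finite F \<and> F \<subseteq> E \<and> p \<in> M"
  then have F: "finite F" "F \<subseteq> E" by auto
  note sn = mnvl_seminorm[OF M, of p]
  have eq: "atom_sum F (restrict (\<lambda>e. coord e x) E) = proj F x"
    unfolding atom_sum_def using F by (intro sum.cong) auto
  have "\<bar>proj F x\<bar> \<le> proj F \<bar>x\<bar>"
  proof -
    have "\<bar>proj F x\<bar> \<le> (\<Sum>e\<in>F. \<bar>coord e x *\<^sub>R e\<bar>)" unfolding atom_sum_def by (rule sum_abs)
    also have "\<dots> = proj F \<bar>x\<bar>"
      unfolding atom_sum_def using F atoms
      by (intro sum.cong) (auto simp: abs_scaleR coord_abs[OF M] less_imp_le[OF atoms_pos])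
    finally show ?thesis .
  qed
  also have "\<dots> \<le> \<bar>x\<bar>" using F by (intro proj_le) auto
  finally have "p (proj F x) \<le> p x" using * by (intro lattice_seminorm_abs_mono[OF sn]) auto
  then show "p (atom_sum F (restrict (\<lambda>e. coord e x) E)) \<le> C p"
    unfolding eq using assms[of p] * by (meson order_trans)
qed auto

text \<open>\<open>\<psi>\<close> inverts the coordinate map on the box. For continuity, half of
  \<open>\<epsilon>\<close> is spent on the tail of \<open>u\<close>, which fixes a finite
  \<open>F\<close> independent of the point \<open>b\<close>; the other half goes to the coordinates
  in \<open>F\<close>.\<close>

lemma coord_synthesis:
  assumes "lebesgue_property M" "levi_property M"
  obtains \<psi> where "continuous_map (subtopology coord_space (coord_box C)) (um_topology M) \<psi>"
    and "\<And>c e. c \<in> coord_box C \<Longrightarrow> e \<in> E \<Longrightarrow> coord e (\<psi> c) = c e"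
proof -
  have "\<exists>l. \<forall>e\<in>E. coord e l = c e" if "c \<in> coord_box C" for c
  proof (rule levi_coord_exists[OF assms(2)])
    show "p (atom_sum F c) \<le> C p" if "p \<in> M" "finite F" "F \<subseteq> E" for p F
      using that \<open>c \<in> coord_box C\<close> unfolding coord_box_def by blast
  qed blast
  then obtain \<psi> where \<psi>: "\<And>c e. c \<in> coord_box C \<Longrightarrow> e \<in> E \<Longrightarrow> coord e (\<psi> c) = c e"
    using bchoice[of "coord_box C" "\<lambda>c l. \<forall>e\<in>E. coord e l = c e"] by blast
  let ?K = "subtopology coord_space (coord_box C)"
  have "continuous_map ?K (um_topology M) \<psi>"
    unfolding continuous_map_atin limitin_um_topology[OF M]
  proof (intro ballI allI impI)
    fix c and u :: 'a and p assume c: "c \<in> topspace ?K" and u: "0 \<le> u" and p: "p \<in> M"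
    note sn = mnvl_seminorm[OF M p]
    show "((\<lambda>b. p (inf \<bar>\<psi> b - \<psi> c\<bar> u)) \<longlongrightarrow> 0) (atin ?K c)"
    proof (rule tendstoI)
      fix \<epsilon> :: real assume "0 < \<epsilon>"
      then obtain F where F: "finite F" "F \<subseteq> E" "p (u - proj F u) < \<epsilon>/2"
        using proj_tail_small[OF assms(1) u p, of "\<epsilon>/2"] by auto
      have "\<forall>\<^sub>F b in atin ?K c. (\<Sum>e\<in>F. \<bar>b e - c e\<bar> * p e) < \<epsilon>/2"
        using \<open>0 < \<epsilon>\<close> by (intro order_tendstoD(2)[OF tendsto_weighted_sum[OF F(2) c]]) simp
      \<comment> \<open>Off the box the values of \<open>\<psi>\<close> are unspecified, so
        \<open>b\<close> must be known to lie in it.\<close>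
      moreover have "\<forall>\<^sub>F b in atin ?K c. b \<in> topspace ?K"
        unfolding eventually_atin using openin_topspace c by blast
      ultimately show "\<forall>\<^sub>F b in atin ?K c. dist (p (inf \<bar>\<psi> b - \<psi> c\<bar> u)) 0 < \<epsilon>"
      proof eventually_elim
        case (elim b)
        have "p (inf \<bar>\<psi> b - \<psi> c\<bar> u) \<le> (\<Sum>e\<in>F. \<bar>coord e (\<psi> b - \<psi> c)\<bar> * p e) + p (u - proj F u)"
          by (rule inf_abs_le_coords[OF sn u F(1,2)])
        also have "(\<Sum>e\<in>F. \<bar>coord e (\<psi> b - \<psi> c)\<bar> * p e) = (\<Sum>e\<in>F. \<bar>b e - c e\<bar> * p e)"
          using F(2) elim(2) c \<psi> by (intro sum.cong) (auto simp: coord_diff[OF M atoms])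
        finally show ?case using elim(1) F(3) lattice_seminorm_nonneg[OF sn] by simp
      qed
    qed
  qed
  then show thesis using \<psi> that by blast
qed

lemma compactin_um_topology:
  assumes "lebesgue_property M" "levi_property M"
    and A: "m_bounded M A" "closedin (um_topology M) A"
  shows "compactin (um_topology M) A"
proof -
  define C where "C p = Sup (p ` A)" for p :: "'a \<Rightarrow> real"
  have C: "p x \<le> C p" if "x \<in> A" "p \<in> M" for x p
    using A(1) that unfolding C_def m_bounded_def by (intro cSup_upper) auto
  obtain \<psi> where \<psi>: "continuous_map (subtopology coord_space (coord_box C)) (um_topology M) \<psi>"
      "\<And>c e. c \<in> coord_box C \<Longrightarrow> e \<in> E \<Longrightarrow> coord e (\<psi> c) = c e"
    using coord_synthesis[OF assms(1,2)] by blast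
  have "compactin (um_topology M) (\<psi> ` coord_box C)"
    using compactin_coord_box by (intro image_compactin[OF _ \<psi>(1)]) (simp add: compactin_subtopology)
  moreover have "A \<subseteq> \<psi> ` coord_box C"
  proof
    fix x assume x: "x \<in> A"
    define c where "c = restrict (\<lambda>e. coord e x) E"
    have c: "c \<in> coord_box C" unfolding c_def using C x by (intro coord_in_coord_box)
    have "x - \<psi> c = 0"
      using \<psi>(2)[OF c] by (intro coord_eq_0_imp) (simp add: coord_diff[OF M atoms] c_def)
    then show "x \<in> \<psi> ` coord_box C" using c by simp
  qed
  ultimately show ?thesis using A(2) by (rule closed_compactin)
qed

end

lemma atomic_lebesgue_levi_imp_compact:
  fixes M :: "('a::vector_lattice \<Rightarrow> real) set"
  assumes "mnvl M" "atomic_vector_lattice TYPE('a)" "lebesgue_property M" "levi_property M"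
    and "m_bounded M A" "closedin (um_topology M) A"
  shows "compactin (um_topology M) A"
proof -
  obtain E :: "'a set" where "\<forall>e\<in>E. atom e" "pairwise (\<lambda>e f. inf e f = 0) E"
      "\<forall>x\<ge>0. (\<forall>e\<in>E. inf x e = 0) \<longrightarrow> x = 0"
    using assms(2) unfolding atomic_vector_lattice_def by blast
  then interpret atom_system M E using assms(1) by unfold_locales auto
  show ?thesis using assms(3-6) by (rule compactin_um_topology)
qed

subsection \<open>Positive functionals dominated by a lattice seminorm\<close>

definition sublinear :: "('a::real_vector \<Rightarrow> real) \<Rightarrow> bool" where
  "sublinear q \<longleftrightarrow> (\<forall>x y. q (x + y) \<le> q x + q y) \<and> (\<forall>t\<ge>0. \<forall>x. q (t *\<^sub>R x) = t * q x)"

lemma sublinearD: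
  assumes "sublinear q"
  shows "q (x + y) \<le> q x + q y" "0 \<le> t \<Longrightarrow> q (t *\<^sub>R x) = t * q x" "q 0 = 0" "- q (- x) \<le> q x"
proof -
  show add: "q (x + y) \<le> q x + q y" for x y using assms by (simp add: sublinear_def)
  show "0 \<le> t \<Longrightarrow> q (t *\<^sub>R x) = t * q x" for t x using assms by (simp add: sublinear_def)
  from this[of 0 x] show z: "q 0 = 0" by simp
  show "- q (- x) \<le> q x" using add[of x "- x"] z by simp
qed

lemma sublinearI:
  assumes add: "\<And>x y. q (x + y) \<le> q x + q y" and zero: "q 0 = 0"
    and scale: "\<And>t x. 0 < t \<Longrightarrow> q (t *\<^sub>R x) \<le> t * q x"
  shows "sublinear q"
proof -
  have "q (t *\<^sub>R x) = t * q x" if "0 \<le> t" for t x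
  proof (cases "t = 0")
    case False
    then have t: "0 < t" using that by simp
    have "q x = q ((1/t) *\<^sub>R (t *\<^sub>R x))" using t by simp
    also have "\<dots> \<le> (1/t) * q (t *\<^sub>R x)" using t by (intro scale) simp
    finally have "t * q x \<le> q (t *\<^sub>R x)" using t by (simp add: field_simps)
    then show ?thesis using scale[OF t, of x] by simp
  qed (simp add: zero)
  then show ?thesis using add by (simp add: sublinear_def)
qed

text \<open>The infimum is finite since \<open>- q (- x) \<le> - r (- x) \<le> r x\<close>.
  Subadditivity is where the chain enters: terms \<open>r x + s y\<close> with different
  \<open>r\<close> and \<open>s\<close> are compared with the smaller of the two
  functionals.\<close>

lemma sublinear_INF_chain:
  assumes ne: "C \<noteq> {}" and sub: "\<And>r. r \<in> C \<Longrightarrow> sublinear r \<and> r \<le> q"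
    and chain: "\<And>r s. r \<in> C \<Longrightarrow> s \<in> C \<Longrightarrow> r \<le> s \<or> s \<le> r"
  shows "sublinear (\<lambda>x. INF r\<in>C. r x)" "\<And>r x. r \<in> C \<Longrightarrow> (INF r\<in>C. r x) \<le> r x"
proof -
  define m where "m x = (INF r\<in>C. r x)" for x
  have bdd: "bdd_below ((\<lambda>r. r x) ` C)" for x
  proof (rule bdd_belowI2)
    fix r assume "r \<in> C"
    then have "sublinear r" "r (- x) \<le> q (- x)" using sub by (auto simp: le_fun_def)
    then show "- q (- x) \<le> r x" using sublinearD(4)[of r x] by simp
  qed
  have le: "m x \<le> r x" if "r \<in> C" for r x unfolding m_def using bdd that by (rule cINF_lower)
  then show "\<And>r x. r \<in> C \<Longrightarrow> (INF r\<in>C. r x) \<le> r x" by (simp add: m_def)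
  have gr: "z \<le> m x" if "\<And>r. r \<in> C \<Longrightarrow> z \<le> r x" for z x
    unfolding m_def using ne that by (rule cINF_greatest)
  have "sublinear m"
  proof (rule sublinearI)
    fix x y
    have "m (x + y) \<le> r x + s y" if rs: "r \<in> C" "s \<in> C" for r s
    proof -
      obtain t where t: "t \<in> C" "t \<le> r" "t \<le> s" using chain[OF rs] rs by blast
      then have "m (x + y) \<le> t x + t y"
        using le[OF t(1), of "x + y"] sublinearD(1)[OF conjunct1[OF sub[OF t(1)]], of x y] by linarith
      also have "\<dots> \<le> r x + s y" using t by (intro add_mono) (auto simp: le_fun_def)
      finally show ?thesis .
    qed
    then have "m (x + y) - s y \<le> m x" if "s \<in> C" for s
      using that by (intro gr) (simp add: algebra_simps)
    then have "m (x + y) - m x \<le> m y" by (intro gr) (simp add: algebra_simps)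
    then show "m (x + y) \<le> m x + m y" by simp
  next
    have zero: "r 0 = 0" if "r \<in> C" for r using sub[OF that] sublinearD(3) by blast
    obtain r where "r \<in> C" using ne by blast
    then have "m 0 \<le> 0" using le[of r 0] zero[of r] by linarith
    moreover have "0 \<le> m 0"
    proof (rule gr)
      show "0 \<le> r 0" if "r \<in> C" for r using zero[OF that] by simp
    qed
    ultimately show "m 0 = 0" by simp
  next
    fix t :: real and x assume t: "0 < t"
    have "m (t *\<^sub>R x) / t \<le> m x"
    proof (rule gr)
      fix r assume r: "r \<in> C"
      then have "m (t *\<^sub>R x) \<le> t * r x"
        using le[OF r, of "t *\<^sub>R x"] t sublinearD(2)[OF conjunct1[OF sub[OF r]], of t x] by simp
      then show "m (t *\<^sub>R x) / t \<le> r x" using t by (simp add: field_simps)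
    qed
    then show "m (t *\<^sub>R x) \<le> t * m x" using t by (simp add: field_simps)
  qed
  then show "sublinear (\<lambda>x. INF r\<in>C. r x)" by (simp add: m_def[abs_def])
qed

lemma sublinear_minimal_exists:
  assumes "sublinear q"
  obtains m where "sublinear m" "m \<le> q" "\<And>r. sublinear r \<Longrightarrow> r \<le> m \<Longrightarrow> r = m"
proof -
  define A where "A = {r. sublinear r \<and> r \<le> q}"
  have "\<exists>m\<in>A. \<forall>r\<in>A. r \<le> m \<longrightarrow> r = m"
  proof (rule predicate_Zorn)
    show "partial_order_on A (relation_of (\<lambda>r s. s \<le> r) A)"
      by (rule partial_order_on_relation_ofI) (blast intro: order_trans antisym)+
  next
    fix C assume C: "C \<in> Chains (relation_of (\<lambda>r s. s \<le> r) A)"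
    then have CA: "r \<in> A" if "r \<in> C" for r
      using that by (auto simp: Chains_def relation_of_def)
    show "\<exists>m\<in>A. \<forall>r\<in>C. m \<le> r"
    proof (cases "C = {}")
      case True
      then show ?thesis using assms by (auto simp: A_def)
    next
      case False
      have sub: "sublinear r \<and> r \<le> q" if "r \<in> C" for r using CA[OF that] by (simp add: A_def)
      have chain: "r \<le> s \<or> s \<le> r" if "r \<in> C" "s \<in> C" for r s
        using C that by (auto simp: Chains_def relation_of_def)
      have inf: "sublinear (\<lambda>x. INF r\<in>C. r x)"
        by (rule sublinear_INF_chain(1)[OF False, of q]) (rule sub chain, assumption+)+
      have inf_le: "(INF r\<in>C. r x) \<le> r x" if "r \<in> C" for r x
        by (rule sublinear_INF_chain(2)[OF False, of q r]) (rule sub chain that, assumption+ | rule that)+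
      obtain r where "r \<in> C" using False by blast
      then have "(\<lambda>x. INF r\<in>C. r x) \<le> r" "r \<le> q"
        using inf_le sub by (auto simp: le_fun_def)
      then have "(\<lambda>x. INF r\<in>C. r x) \<le> q" by (rule order_trans)
      then have "(\<lambda>x. INF r\<in>C. r x) \<in> A" using inf by (simp add: A_def)
      moreover have "(\<lambda>x. INF r\<in>C. r x) \<le> r" if "r \<in> C" for r
        using inf_le[OF that] by (simp add: le_fun_def)
      ultimately show ?thesis by blast
    qed
  qed
  then obtain m where m: "m \<in> A" "\<And>r. r \<in> A \<Longrightarrow> r \<le> m \<Longrightarrow> r = m" by blast
  show thesis
  proof (rule that)
    show "sublinear m" "m \<le> q" using m by (auto simp: A_def)
    show "r = m" if r: "sublinear r" "r \<le> m" for r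
    proof (rule m(2))
      have "r \<le> q" using r(2) m(1) unfolding A_def by (blast intro: order_trans)
      then show "r \<in> A" using r by (simp add: A_def)
    qed (rule r)
  qed
qed

text \<open>\<open>g\<close> is the one-sided directional derivative of \<open>q\<close> at
  \<open>y\<close>: for \<open>t = 1/h\<close> the expression
  \<open>q (x + t *\<^sub>R y) - t * q y\<close> is the difference quotient at \<open>y\<close> in
  direction \<open>x\<close> with step \<open>h\<close>.\<close>

lemma sublinear_shrink:
  assumes q: "sublinear q"
  obtains g where "sublinear g" "g \<le> q" "\<And>x. g x \<le> q (x + y) - q y"
proof -
  define g where "g x = (INF t\<in>{0..}. q (x + t *\<^sub>R y) - t * q y)" for x
  have lb: "- q (- x) \<le> q (x + t *\<^sub>R y) - t * q y" if "0 \<le> t" for x t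
  proof -
    have "t * q y = q ((x + t *\<^sub>R y) + (- x))" using sublinearD(2)[OF q that] by simp
    also have "\<dots> \<le> q (x + t *\<^sub>R y) + q (- x)" by (rule sublinearD(1)[OF q])
    finally show ?thesis by simp
  qed
  have bdd: "bdd_below ((\<lambda>t. q (x + t *\<^sub>R y) - t * q y) ` {0..})" for x
    using lb by (intro bdd_belowI2) auto
  have le: "g x \<le> q (x + t *\<^sub>R y) - t * q y" if "0 \<le> t" for x t
    unfolding g_def using bdd that by (intro cINF_lower) auto
  have gr: "z \<le> g x" if "\<And>t. 0 \<le> t \<Longrightarrow> z \<le> q (x + t *\<^sub>R y) - t * q y" for z x
    unfolding g_def using that by (intro cINF_greatest) auto
  have "sublinear g"
  proof (rule sublinearI)
    fix x z
    have *: "g (x + z) \<le> (q (x + s *\<^sub>R y) - s * q y) + (q (z + t *\<^sub>R y) - t * q y)"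
      if "0 \<le> s" "0 \<le> t" for s t
    proof -
      have "g (x + z) \<le> q ((x + z) + (s + t) *\<^sub>R y) - (s + t) * q y" using that by (intro le) simp
      also have "(x + z) + (s + t) *\<^sub>R y = (x + s *\<^sub>R y) + (z + t *\<^sub>R y)"
        by (simp add: algebra_simps)
      also have "q \<dots> - (s + t) * q y \<le> (q (x + s *\<^sub>R y) - s * q y) + (q (z + t *\<^sub>R y) - t * q y)"
        using sublinearD(1)[OF q, of "x + s *\<^sub>R y" "z + t *\<^sub>R y"] by (simp add: algebra_simps)
      finally show ?thesis .
    qed
    have **: "g (x + z) - (q (z + t *\<^sub>R y) - t * q y) \<le> g x" if "0 \<le> t" for t
      using *[OF _ that] by (intro gr) (simp only: diff_le_eq)
    have "g (x + z) - g x \<le> g z"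
    proof (rule gr)
      show "g (x + z) - g x \<le> q (z + t *\<^sub>R y) - t * q y" if "0 \<le> t" for t
        using **[OF that] by linarith
    qed
    then show "g (x + z) \<le> g x + g z" by simp
  next
    have "0 \<le> g 0" using lb[of _ 0] sublinearD(3)[OF q] by (intro gr) simp
    moreover have "g 0 \<le> 0" using le[of 0 0] sublinearD(3)[OF q] by simp
    ultimately show "g 0 = 0" by simp
  next
    fix s :: real and x assume s: "0 < s"
    have "g (s *\<^sub>R x) / s \<le> g x"
    proof (rule gr)
      fix t :: real assume t: "0 \<le> t"
      have "g (s *\<^sub>R x) \<le> q (s *\<^sub>R x + (s * t) *\<^sub>R y) - (s * t) * q y" using s t by (intro le) simp
      also have "s *\<^sub>R x + (s * t) *\<^sub>R y = s *\<^sub>R (x + t *\<^sub>R y)" by (simp add: algebra_simps)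
      also have "q \<dots> - (s * t) * q y = s * (q (x + t *\<^sub>R y) - t * q y)"
        using sublinearD(2)[OF q, of s "x + t *\<^sub>R y"] s by (simp add: right_diff_distrib)
      finally show "g (s *\<^sub>R x) / s \<le> q (x + t *\<^sub>R y) - t * q y" using s by (simp add: field_simps)
    qed
    then show "g (s *\<^sub>R x) \<le> s * g x" using s by (simp add: field_simps)
  qed
  moreover have "g \<le> q" using le[of 0] by (simp add: le_fun_def)
  moreover have "g x \<le> q (x + y) - q y" for x using le[of 1 x] by simp
  ultimately show thesis by (rule that)
qed

text \<open>Shrinking at \<open>y\<close> cannot lower a minimal \<open>m\<close>, so
  \<open>m x \<le> m (x + y) - m y\<close>; this is superadditivity.\<close>

lemma sublinear_minimal_linear:
  assumes m: "sublinear m" and min: "\<And>r. sublinear r \<Longrightarrow> r \<le> m \<Longrightarrow> r = m"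
  shows "linear m"
proof (rule linearI)
  have add: "m (x + y) = m x + m y" for x y
  proof -
    obtain g where "sublinear g" "g \<le> m" "\<And>x. g x \<le> m (x + y) - m y"
      using sublinear_shrink[OF m, of y] by blast
    then have "m x \<le> m (x + y) - m y" using min by blast
    then show ?thesis using sublinearD(1)[OF m, of x y] by simp
  qed
  then show "m (x + y) = m x + m y" for x y .
  fix t x
  show "m (t *\<^sub>R x) = t *\<^sub>R m x"
  proof (cases "0 \<le> t")
    case False
    have "m (t *\<^sub>R x) + m ((- t) *\<^sub>R x) = 0"
      using add[of "t *\<^sub>R x" "(- t) *\<^sub>R x"] sublinearD(3)[OF m] by simp
    moreover have "m ((- t) *\<^sub>R x) = (- t) * m x" using False by (intro sublinearD(2)[OF m]) simp
    ultimately show ?thesis by simp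
  qed (simp add: sublinearD(2)[OF m])
qed

text \<open>Shrinking at \<open>u\<close> before minimising gives
  \<open>g (- u) \<le> - q u\<close>, which forces every linear functional below \<open>g\<close> to
  take at least the value \<open>q u\<close> at \<open>u\<close>.\<close>

lemma sublinear_support:
  assumes q: "sublinear q"
  obtains f where "linear f" "\<And>x. f x \<le> q x" "f u = q u"
proof -
  obtain g where g: "sublinear g" "g \<le> q" "\<And>x. g x \<le> q (x + u) - q u"
    using sublinear_shrink[OF q, of u] by blast
  obtain f where f: "sublinear f" "f \<le> g" "\<And>r. sublinear r \<Longrightarrow> r \<le> f \<Longrightarrow> r = f"
    using sublinear_minimal_exists[OF g(1)] by blast
  have lin: "linear f" using f by (intro sublinear_minimal_linear)
  have le: "f x \<le> q x" for x using f(2) g(2) by (meson le_fun_def order_trans)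
  have "f (- u) \<le> g (- u)" using f(2) by (simp add: le_fun_def)
  also have "\<dots> \<le> - q u" using g(3)[of "- u"] sublinearD(3)[OF q] by simp
  finally have "f u = q u" using le[of u] linear_neg[OF lin, of u] by simp
  then show thesis using that lin le by blast
qed

lemma lattice_seminorm_support:
  fixes p :: "'a::vector_lattice \<Rightarrow> real"
  assumes p: "lattice_seminorm p" and u: "0 \<le> u"
  obtains f where "linear f" "\<And>x. f x \<le> p x" "\<And>x. 0 \<le> x \<Longrightarrow> 0 \<le> f x" "f u = p u"
proof -
  \<comment> \<open>Passing from \<open>p\<close> to its composition with \<open>pprt\<close> yields
    positivity for free: the bound vanishes on negative elements.\<close>
  have "sublinear (\<lambda>x. p (pprt x))"
  proof (rule sublinearI)
    fix x y :: 'a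
    have "p (pprt (x + y)) \<le> p (pprt x + pprt y)"
    proof (rule lattice_seminorm_mono[OF p])
      have "x \<le> pprt x" "y \<le> pprt y" by (simp_all add: pprt_def)
      then show "pprt (x + y) \<le> pprt x + pprt y"
        by (simp add: pprt_le_iff add_mono)
    qed simp
    also have "\<dots> \<le> p (pprt x) + p (pprt y)" by (rule lattice_seminorm_triangle[OF p])
    finally show "p (pprt (x + y)) \<le> p (pprt x) + p (pprt y)" .
  next
    fix t :: real and x :: 'a assume t: "0 < t"
    have "p (pprt (t *\<^sub>R x)) \<le> p (t *\<^sub>R pprt x)"
    proof (rule lattice_seminorm_mono[OF p])
      have "x \<le> pprt x" by (simp add: pprt_def)
      then show "pprt (t *\<^sub>R x) \<le> t *\<^sub>R pprt x"
        using t by (simp add: pprt_le_iff scaleR_left_mono scaleR_nonneg_nonneg)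
    qed simp
    then show "p (pprt (t *\<^sub>R x)) \<le> t * p (pprt x)"
      using t by (simp add: lattice_seminorm_scaleR[OF p])
  qed (simp add: lattice_seminorm_zero[OF p])
  then obtain f where f: "linear f" "\<And>x. f x \<le> p (pprt x)" "f u = p (pprt u)"
    using sublinear_support by blast
  have "f x \<le> p x" for x
  proof -
    have "p (pprt x) \<le> p x"
      by (intro lattice_seminorm_abs_mono[OF p]) (simp add: pprt_le_iff abs_ge_self)
    then show ?thesis using f(2)[of x] by simp
  qed
  moreover have "0 \<le> f x" if "0 \<le> x" for x
    using f(2)[of "- x"] that linear_neg[OF f(1), of x] by (simp add: lattice_seminorm_zero[OF p])
  ultimately show thesis using that f(1,3) u by simp
qed

subsection \<open>Consequences of compactness\<close>

lemma directed_index_trans: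
  assumes "directed_index I le" "i \<in> I" "j \<in> I" "k \<in> I" "le i j" "le j k"
  shows "le i k"
  using assms transp_onD[of I le i j k] by (simp add: directed_index_def)

lemma directed_index_bound:
  assumes "directed_index I le" "i \<in> I" "j \<in> I"
  obtains k where "k \<in> I" "le i k" "le j k"
  using assms unfolding directed_index_def by blast

text \<open>Without a cluster point, the open sets that the net eventually avoids cover
  \<open>K\<close>. By directedness the net eventually avoids a finite subcover, yet it stays in
  \<open>K\<close>.\<close>

lemma compactin_net_cluster:
  assumes K: "compactin X K" and dir: "directed_index I le" and x: "\<And>i. i \<in> I \<Longrightarrow> x i \<in> K"
  shows "\<exists>y\<in>K. \<forall>U i. openin X U \<and> y \<in> U \<and> i \<in> I \<longrightarrow> (\<exists>j\<in>I. le i j \<and> x j \<in> U)"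
proof (rule ccontr)
  assume contr: "\<not> ?thesis"
  define V where "V = {U. openin X U \<and> (\<exists>i\<in>I. \<forall>j\<in>I. le i j \<longrightarrow> x j \<notin> U)}"
  have "K \<subseteq> \<Union>V"
  proof
    fix y assume "y \<in> K"
    then obtain U i where "openin X U" "y \<in> U" "i \<in> I" "\<not> (\<exists>j\<in>I. le i j \<and> x j \<in> U)"
      using contr by meson
    then show "y \<in> \<Union>V" unfolding V_def by blast
  qed
  moreover have "\<forall>U\<in>V. openin X U" by (simp add: V_def)
  ultimately have "\<exists>W. finite W \<and> W \<subseteq> V \<and> K \<subseteq> \<Union>W" using K by (simp add: compactin_def)
  then obtain W where W: "finite W" "W \<subseteq> V" "K \<subseteq> \<Union>W" by blast
  have "\<exists>i\<in>I. \<forall>U\<in>W. \<forall>j\<in>I. le i j \<longrightarrow> x j \<notin> U"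
    using W(1,2)
  proof (induction W)
    case empty
    then show ?case using dir by (auto simp: directed_index_def)
  next
    case (insert U W)
    then obtain i where i: "i \<in> I" "\<forall>U\<in>W. \<forall>j\<in>I. le i j \<longrightarrow> x j \<notin> U" by blast
    obtain k where k: "k \<in> I" "\<forall>j\<in>I. le k j \<longrightarrow> x j \<notin> U"
      using insert.prems by (auto simp: V_def)
    obtain l where l: "l \<in> I" "le i l" "le k l"
      using directed_index_bound[OF dir i(1) k(1)] by blast
    have "le i j" "le k j" if "j \<in> I" "le l j" for j
      using directed_index_trans[OF dir _ l(1) that(1) _ that(2)] l i(1) k(1) by blast+
    then show ?case using i k l by blast
  qed
  then obtain i where i: "i \<in> I" "\<And>U j. U \<in> W \<Longrightarrow> j \<in> I \<Longrightarrow> le i j \<Longrightarrow> x j \<notin> U" by blast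
  have "le i i" using dir i(1) by (auto simp: directed_index_def reflp_on_def)
  then show False using i x[OF i(1)] W(3) by blast
qed

text \<open>At a point \<open>y\<close> outside, the test element is \<open>\<bar>y\<bar>\<close>
  itself: from \<open>\<bar>y\<bar> \<le> \<bar>y + z\<bar> + inf \<bar>z\<bar>
  \<bar>y\<bar>\<close>, a perturbation \<open>z\<close> that is small in the um-sense cannot lower
  \<open>p y\<close> to \<open>C p\<close>.\<close>

lemma closedin_seminorm_bounds:
  fixes M :: "('a::vector_lattice \<Rightarrow> real) set"
  assumes M: "mnvl M"
  shows "closedin (um_topology M) {x. \<forall>p\<in>M. p x \<le> C p}"
  unfolding closedin_def topspace_um_topology[OF M] openin_um_topology[OF M]
proof (intro conjI ballI)
  fix y assume "y \<in> UNIV - {x. \<forall>p\<in>M. p x \<le> C p}"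
  then obtain p where p: "p \<in> M" "C p < p y" by force
  note sn = mnvl_seminorm[OF M p(1)]
  have "(+) y ` um_ball p \<bar>y\<bar> (p y - C p) \<subseteq> UNIV - {x. \<forall>p\<in>M. p x \<le> C p}"
  proof (intro image_subsetI DiffI UNIV_I notI)
    fix z assume z: "z \<in> um_ball p \<bar>y\<bar> (p y - C p)" and *: "y + z \<in> {x. \<forall>p\<in>M. p x \<le> C p}"
    have "\<bar>y\<bar> \<le> \<bar>y + z\<bar> + \<bar>z\<bar>" using abs_triangle_ineq4[of "y + z" z] by simp
    then have "\<bar>y\<bar> \<le> \<bar>y + z\<bar> + inf \<bar>z\<bar> \<bar>y\<bar>" by (simp add: add_inf_distrib_left)
    then have "p y \<le> p (\<bar>y + z\<bar> + inf \<bar>z\<bar> \<bar>y\<bar>)" by (intro lattice_seminorm_abs_mono[OF sn]) simp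
    also have "\<dots> \<le> p \<bar>y + z\<bar> + p (inf \<bar>z\<bar> \<bar>y\<bar>)" by (rule lattice_seminorm_triangle[OF sn])
    also have "p \<bar>y + z\<bar> \<le> p (y + z)" by (intro lattice_seminorm_abs_mono[OF sn]) simp
    also have "\<dots> \<le> C p" using * p(1) by blast
    finally show False using z by (simp add: um_ball_def)
  qed
  then show "\<exists>p\<in>M. \<exists>u\<ge>0. \<exists>e>0. (+) y ` um_ball p u e \<subseteq> UNIV - {x. \<forall>p\<in>M. p x \<le> C p}"
    using p by (intro bexI[of _ p] exI[of _ "\<bar>y\<bar>"] conjI exI[of _ "p y - C p"]) auto
qed simp

locale um_compact =
  fixes M :: "('a::vector_lattice \<Rightarrow> real) set"
  assumes M: "mnvl M"
    and compact: "\<And>A. m_bounded M A \<Longrightarrow> closedin (um_topology M) A \<Longrightarrow> compactin (um_topology M) A"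
begin

lemma compactin_seminorm_bounds: "compactin (um_topology M) {x. \<forall>p\<in>M. p x \<le> C p}"
  using closedin_seminorm_bounds[OF M, of C]
  by (intro compact) (auto simp: m_bounded_def bdd_above_def)

text \<open>The second conclusion translates clustering into order: with \<open>pprt w\<close> as
  test element, the truncation of \<open>\<bar>x j - y\<bar>\<close> is \<open>pprt w\<close>, so
  every seminorm of it is arbitrarily small.\<close>

lemma bounded_net_cluster:
  fixes x :: "'i \<Rightarrow> 'a"
  assumes dir: "directed_index I le" and bound: "\<And>i p. i \<in> I \<Longrightarrow> p \<in> M \<Longrightarrow> p (x i) \<le> C p"
  obtains y where "\<And>p u \<epsilon> i. p \<in> M \<Longrightarrow> 0 \<le> u \<Longrightarrow> 0 < \<epsilon> \<Longrightarrow> i \<in> I \<Longrightarrow>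
      \<exists>j\<in>I. le i j \<and> p (inf \<bar>x j - y\<bar> u) < \<epsilon>"
    and "\<And>w i. i \<in> I \<Longrightarrow> \<forall>j\<in>I. le i j \<longrightarrow> w \<le> \<bar>x j - y\<bar> \<Longrightarrow> w \<le> 0"
proof -
  have "\<And>i. i \<in> I \<Longrightarrow> x i \<in> {x. \<forall>p\<in>M. p x \<le> C p}" using bound by blast
  from compactin_net_cluster[where x = x, OF compactin_seminorm_bounds dir this]
  obtain y where y: "\<And>U i. openin (um_topology M) U \<Longrightarrow> y \<in> U \<Longrightarrow> i \<in> I \<Longrightarrow>
      \<exists>j\<in>I. le i j \<and> x j \<in> U"
    by blast
  have near: "\<exists>j\<in>I. le i j \<and> p (inf \<bar>x j - y\<bar> u) < \<epsilon>"
    if hyps: "p \<in> M" "0 \<le> u" "0 < \<epsilon>" "i \<in> I" for p u \<epsilon> i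
  proof -
    obtain U where U: "openin (um_topology M) U" "y \<in> U" "U \<subseteq> (+) y ` um_ball p u \<epsilon>"
      using um_ball_neighbourhood[OF M hyps(1-3)] by blast
    then obtain j where "j \<in> I" "le i j" "x j \<in> (+) y ` um_ball p u \<epsilon>"
      using y[OF U(1,2) hyps(4)] by blast
    then show ?thesis by (intro bexI[of _ j]) (auto simp: um_ball_def)
  qed
  have "w \<le> 0" if i: "i \<in> I" and w: "\<forall>j\<in>I. le i j \<longrightarrow> w \<le> \<bar>x j - y\<bar>" for w i
  proof -
    have "pprt w = 0"
    proof (rule mnvl_eq_0[OF M])
      fix p and \<epsilon> :: real assume p: "p \<in> M" and "0 < \<epsilon>"
      then obtain j where j: "j \<in> I" "le i j" "p (inf \<bar>x j - y\<bar> (pprt w)) < \<epsilon>"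
        using near[OF p zero_le_pprt _ i] by blast
      moreover have "pprt w \<le> \<bar>x j - y\<bar>" using w j(1,2) by (simp add: pprt_le_iff)
      ultimately show "p (pprt w) < \<epsilon>" by (simp add: inf_absorb2)
    qed
    then show ?thesis by (simp add: le_zero_iff_zero_pprt)
  qed
  with near show thesis by (rule that)
qed

text \<open>A cluster point \<open>y\<close> is the supremum: beyond \<open>i\<close> monotonicity
  gives \<open>x i - y \<le> \<bar>x j - y\<bar>\<close>, and for an upper bound \<open>z\<close>
  one has \<open>y - z \<le> \<bar>x j - y\<bar>\<close>. Such eventual lower bounds are
  nonpositive.\<close>

lemma compact_imp_levi: "levi_property M"
  unfolding levi_property_def
proof (intro allI impI, elim conjE)
  fix I :: "'a set" and le x
  assume dir: "directed_index I le" and mono: "monotone_on I le (\<le>) x"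
    and bdd: "m_bounded M (x ` I)"
  have le_Sup: "p (x i) \<le> Sup (p ` x ` I)" if "i \<in> I" "p \<in> M" for i p
    using bdd that unfolding m_bounded_def by (intro cSup_upper) auto
  obtain y where
    "\<And>p u \<epsilon> i. p \<in> M \<Longrightarrow> 0 \<le> u \<Longrightarrow> 0 < \<epsilon> \<Longrightarrow> i \<in> I \<Longrightarrow>
        \<exists>j\<in>I. le i j \<and> p (inf \<bar>x j - y\<bar> u) < \<epsilon>" and
    y: "\<And>w i. i \<in> I \<Longrightarrow> \<forall>j\<in>I. le i j \<longrightarrow> w \<le> \<bar>x j - y\<bar> \<Longrightarrow> w \<le> 0"
    using bounded_net_cluster[of I le x "\<lambda>p. Sup (p ` x ` I)"] dir le_Sup
    by blast
  have "isLub UNIV (x ` I) y"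
  proof (rule isLubI2)
    have "x i \<le> y" if i: "i \<in> I" for i
    proof -
      have "x i - y \<le> 0"
      proof (rule y[OF i], intro ballI impI)
        fix j assume "j \<in> I" "le i j"
        then have "x i - y \<le> x j - y" using mono i by (auto simp: monotone_on_def)
        then show "x i - y \<le> \<bar>x j - y\<bar>" using abs_ge_self order_trans by blast
      qed
      then show ?thesis by simp
    qed
    then show "isUb UNIV (x ` I) y" by (auto simp: isUb_def setle_def)
    show "y <=* Collect (isUb UNIV (x ` I))"
      unfolding setge_def
    proof
      fix z assume "z \<in> Collect (isUb UNIV (x ` I))"
      then have z: "x i \<le> z" if "i \<in> I" for i using that by (auto simp: isUb_def setle_def)
      obtain i where i: "i \<in> I" using dir by (auto simp: directed_index_def)
      have "y - z \<le> 0"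
      proof (rule y[OF i], intro ballI impI)
        fix j assume "j \<in> I" "le i j"
        then have "y - z \<le> - (x j - y)" using z by simp
        then show "y - z \<le> \<bar>x j - y\<bar>" using abs_ge_minus_self order_trans by blast
      qed
      then show "y \<le> z" by simp
    qed
  qed
  then show "\<exists>l. increases_to I le x l" using mono by (auto simp: increases_to_def)
qed

lemma compact_imp_lebesgue: "lebesgue_property M"
  unfolding lebesgue_property_def
proof (intro allI impI, elim conjE)
  fix I :: "'a set" and le and x :: "'a \<Rightarrow> 'a"
  assume dir: "directed_index I le" and dec: "decreases_to I le x 0"
  have mono: "x j \<le> x i" if "i \<in> I" "j \<in> I" "le i j" for i j
    using dec that by (auto simp: decreases_to_def monotone_on_def)
  have glb: "isGlb UNIV (x ` I) 0" using dec by (simp add: decreases_to_def)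
  have nn: "0 \<le> x i" if "i \<in> I" for i using isGlbD2[OF glb] that by blast
  obtain i0 where i0: "i0 \<in> I" using dir by (auto simp: directed_index_def)
  \<comment> \<open>The whole net need not be m-bounded, but beyond \<open>i0\<close> it stays in
    \<open>[0, x i0]\<close>.\<close>
  define J where "J = {i \<in> I. le i0 i}"
  have J: "j \<in> I" "x j \<le> x i0" if "j \<in> J" for j
    using that mono i0 by (auto simp: J_def)
  have cofinal: "\<exists>k\<in>J. le i k \<and> le j k" if "i \<in> I" "j \<in> I" for i j
  proof -
    obtain k where k: "k \<in> I" "le i k" "le j k"
      using directed_index_bound[OF dir \<open>i \<in> I\<close> \<open>j \<in> I\<close>] by blast
    obtain l where l: "l \<in> I" "le i0 l" "le k l"
      using directed_index_bound[OF dir i0 k(1)] by blast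
    have "le i l" "le j l" using directed_index_trans[OF dir _ k(1) l(1) _ l(3)] k \<open>i \<in> I\<close> \<open>j \<in> I\<close> by blast+
    then show ?thesis using l by (auto simp: J_def)
  qed
  have "directed_index J le"
    unfolding directed_index_def
  proof (intro conjI ballI)
    show "J \<noteq> {}" using cofinal[OF i0 i0] by blast
    show "reflp_on J le" using dir by (auto simp: directed_index_def reflp_on_def J_def)
    have "J \<subseteq> I" by (auto simp: J_def)
    then show "transp_on J le"
      using dir transp_on_subset[of I le J] by (simp add: directed_index_def)
    show "\<exists>k\<in>J. le i k \<and> le j k" if "i \<in> J" "j \<in> J" for i j using cofinal J(1) that by blast
  qed
  moreover have "p (x j) \<le> p (x i0)" if "j \<in> J" "p \<in> M" for j p
    using J[OF that(1)] nn mnvl_seminorm[OF M that(2)] by (intro lattice_seminorm_mono) auto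
  ultimately obtain y where
    near: "\<And>p u \<epsilon> i. p \<in> M \<Longrightarrow> 0 \<le> u \<Longrightarrow> 0 < \<epsilon> \<Longrightarrow> i \<in> J \<Longrightarrow>
        \<exists>j\<in>J. le i j \<and> p (inf \<bar>x j - y\<bar> u) < \<epsilon>" and
    y: "\<And>w i. i \<in> J \<Longrightarrow> \<forall>j\<in>J. le i j \<longrightarrow> w \<le> \<bar>x j - y\<bar> \<Longrightarrow> w \<le> 0"
    using bounded_net_cluster[of J le x "\<lambda>p. p (x i0)"] by blast
  obtain j0 where j0: "j0 \<in> J" using cofinal[OF i0 i0] by blast
  have "y \<le> x i" if i: "i \<in> I" for i
  proof -
    obtain k where k: "k \<in> J" "le i k" using cofinal[OF i i] by blast
    have "y - x k \<le> 0"
    proof (rule y[OF k(1)], intro ballI impI)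
      fix j assume "j \<in> J" "le k j"
      then have "y - x k \<le> - (x j - y)" using mono J(1) k(1) by simp
      then show "y - x k \<le> \<bar>x j - y\<bar>" using abs_ge_minus_self order_trans by blast
    qed
    then show ?thesis using mono[OF i J(1)[OF k(1)] k(2)] by simp
  qed
  then have "y \<le> 0"
    using glb by (auto simp: isGlb_def greatestP_def isLb_def setle_def setge_def)
  moreover have "- y \<le> 0"
  proof (rule y[OF j0], intro ballI impI)
    fix j assume "j \<in> J" "le j0 j"
    then have "- y \<le> x j - y" using nn J(1) by simp
    then show "- y \<le> \<bar>x j - y\<bar>" using abs_ge_self order_trans by blast
  qed
  ultimately have y0: "y = 0" by simp
  show "m_converges M I le x 0"
    unfolding m_converges_def
  proof (intro ballI allI impI)
    fix p and \<epsilon> :: real assume p: "p \<in> M" and "0 < \<epsilon>"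
    then obtain j where j: "j \<in> J" "p (inf \<bar>x j - y\<bar> (x i0)) < \<epsilon>"
      using near[OF p nn[OF i0] _ j0] by blast
    \<comment> \<open>Truncation at \<open>x i0\<close> has no effect on \<open>x j\<close>. One
      small value is enough, since later ones are smaller still.\<close>
    then have "p (x j) < \<epsilon>" using J[OF j(1)] nn y0 by (simp add: inf_absorb1)
    moreover have "p (x k) \<le> p (x j)" if "k \<in> I" "le j k" for k
      using that mono J(1)[OF j(1)] nn mnvl_seminorm[OF M p] by (intro lattice_seminorm_mono) auto
    ultimately have "\<forall>k\<in>I. le j k \<longrightarrow> p (x k - 0) < \<epsilon>" by force
    then show "\<exists>i\<in>I. \<forall>j\<in>I. le i j \<longrightarrow> p (x j - 0) < \<epsilon>" using J(1)[OF j(1)] by blast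
  qed
qed

lemma order_interval_totally_bounded:
  assumes p: "p \<in> M" and u: "0 \<le> u" and \<epsilon>: "0 < \<epsilon>"
  obtains Y where "finite Y" "\<And>x. 0 \<le> x \<Longrightarrow> x \<le> u \<Longrightarrow> \<exists>y\<in>Y. p (inf \<bar>x - y\<bar> u) < \<epsilon>"
proof -
  let ?K = "{x. \<forall>q\<in>M. q x \<le> q u}"
  define N where "N y = (SOME U. openin (um_topology M) U \<and> y \<in> U \<and> U \<subseteq> (+) y ` um_ball p u \<epsilon>)" for y
  have N: "openin (um_topology M) (N y) \<and> y \<in> N y \<and> N y \<subseteq> (+) y ` um_ball p u \<epsilon>" for y
    unfolding N_def by (rule someI_ex) (rule um_ball_neighbourhood[OF M p u \<epsilon>])
  have "?K \<subseteq> \<Union>(range N)" using N by blast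
  moreover have "\<forall>U\<in>range N. openin (um_topology M) U" using N by blast
  ultimately have "\<exists>W. finite W \<and> W \<subseteq> range N \<and> ?K \<subseteq> \<Union>W"
    using compactin_seminorm_bounds[of "\<lambda>q. q u"] by (simp only: compactin_def)
  then obtain W where W: "finite W" "W \<subseteq> range N" "?K \<subseteq> \<Union>W" by blast
  obtain Y where Y: "finite Y" "W = N ` Y" using finite_subset_image[OF W(1,2)] by blast
  have "\<exists>y\<in>Y. p (inf \<bar>x - y\<bar> u) < \<epsilon>" if x: "0 \<le> x" "x \<le> u" for x
  proof -
    have "x \<in> ?K" using x mnvl_seminorm[OF M] by (auto intro: lattice_seminorm_mono)
    then obtain y where "y \<in> Y" "x \<in> N y" using W(3) Y(2) by blast
    then show ?thesis using N[of y] by (intro bexI[of _ y]) (auto simp: um_ball_def)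
  qed
  with Y(1) show thesis by (rule that)
qed

end

subsection \<open>Components\<close>

text \<open>Components (or fragments) of \<open>w\<close> are the parts of its disjoint two-term
  splittings; \<open>0 \<le> c\<close> and \<open>c \<le> w\<close> follow from the meet being
  0.\<close>

definition component :: "'a::vector_lattice \<Rightarrow> 'a \<Rightarrow> bool" where
  "component w c \<longleftrightarrow> inf c (w - c) = 0"

lemma component_bounds:
  assumes "component w c"
  shows "0 \<le> c" "c \<le> w"
  using disjoint_nonneg[of c "w - c"] assms by (auto simp: component_def)

lemma component_complement: "component w c \<Longrightarrow> component w (w - c)"
  by (simp add: component_def inf_commute)

lemma component_self: "0 \<le> w \<Longrightarrow> component w w"
  by (simp add: component_def inf_absorb2)

text \<open>\<open>inf c d\<close> is disjoint from both \<open>w - c\<close> and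
  \<open>w - d\<close>, and the sum of these dominates \<open>w - inf c d\<close>.\<close>

lemma component_inf:
  assumes "component w c" "component w d"
  shows "component w (inf c d)"
  unfolding component_def
proof (rule disjoint_mono)
  note b = component_bounds[OF assms(1)] component_bounds[OF assms(2)]
  have "inf (inf c d) (w - c) = 0"
    by (rule disjoint_mono[OF assms(1)[unfolded component_def]]) (use b in simp_all)
  moreover have "inf (inf c d) (w - d) = 0"
    by (rule disjoint_mono[OF assms(2)[unfolded component_def]]) (use b in simp_all)
  ultimately show "inf (inf c d) ((w - c) + (w - d)) = 0" by (rule disjoint_add)
  show "0 \<le> inf c d" "inf c d \<le> inf c d" using b by auto
  show "0 \<le> w - inf c d" using b by (simp add: le_infI1 del: diff_inf_eq_sup)
  have "c + d = sup c d + inf c d" by (rule add_eq_inf_sup)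
  also have "\<dots> \<le> w + inf c d" using b by (intro add_right_mono) simp
  finally have "0 \<le> (w + inf c d) - (c + d)" by (simp only: diff_ge_0_iff_ge)
  also have "(w + inf c d) - (c + d) = ((w - c) + (w - d)) - (w - inf c d)"
    by (simp only: diff_conv_add_uminus minus_add_distrib minus_minus ac_simps) simp
  finally show "w - inf c d \<le> (w - c) + (w - d)" by (simp only: diff_ge_0_iff_ge)
qed

lemma component_trans:
  assumes "component w d" "component d c"
  shows "component w c"
proof -
  have "inf c (w - d) = 0"
    by (rule disjoint_mono[OF assms(1)[unfolded component_def]])
      (use component_bounds[OF assms(1)] component_bounds[OF assms(2)] in simp_all)
  moreover have "inf c (d - c) = 0" using assms(2) by (simp add: component_def)
  ultimately have "inf c ((w - d) + (d - c)) = 0" by (rule disjoint_add)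
  then show ?thesis by (simp add: component_def)
qed

lemma atomI_multiples:
  fixes w :: "'a::vector_lattice"
  assumes w: "0 < w" and mult: "\<And>y k. 0 \<le> y \<Longrightarrow> 0 \<le> k \<Longrightarrow> y \<le> k *\<^sub>R w \<Longrightarrow> \<exists>t. y = t *\<^sub>R w"
  shows "atom w"
proof -
  have "order_ideal (span {w})"
    unfolding order_ideal_def
  proof (intro conjI allI impI)
    show "subspace (span {w})" by (rule subspace_span)
    fix x y assume "y \<in> span {w} \<and> \<bar>x\<bar> \<le> \<bar>y\<bar>"
    then obtain k where k: "\<bar>x\<bar> \<le> \<bar>k *\<^sub>R w\<bar>" by (auto simp: span_singleton)
    then have x: "\<bar>x\<bar> \<le> \<bar>k\<bar> *\<^sub>R w" using w by (simp add: abs_scaleR)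
    have "pprt x \<le> \<bar>x\<bar>" "pprt (- x) \<le> \<bar>x\<bar>" by (simp_all add: pprt_le_iff abs_ge_self abs_ge_minus_self)
    then have "pprt x \<le> \<bar>k\<bar> *\<^sub>R w" "pprt (- x) \<le> \<bar>k\<bar> *\<^sub>R w" using x by (auto intro: order_trans)
    then obtain s t where "pprt x = s *\<^sub>R w" "pprt (- x) = t *\<^sub>R w"
      using mult[of "pprt x" "\<bar>k\<bar>"] mult[of "pprt (- x)" "\<bar>k\<bar>"] by auto
    moreover have "x = pprt x - pprt (- x)" by (simp add: pprt_neg flip: prts)
    ultimately have "x = (s - t) *\<^sub>R w" by (simp add: scaleR_diff_left)
    then show "x \<in> span {w}" by (auto simp: span_singleton)
  qed
  then have "order_ideal hull {w} \<subseteq> span {w}" by (intro hull_minimal) (auto simp: span_base)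
  moreover have "span {w} \<subseteq> order_ideal hull {w}"
    unfolding hull_def
  proof (intro Inter_greatest)
    fix J assume "J \<in> {J. order_ideal J \<and> {w} \<subseteq> J}"
    then show "span {w} \<subseteq> J" by (intro span_minimal) (auto simp: order_ideal_def)
  qed
  ultimately show ?thesis using w by (simp add: atom_def)
qed

subsection \<open>Separated points in order intervals without atoms\<close>

text \<open>The points play the role of Rademacher functions: if every \<open>w \<le> u\<close> can be split
  into two disjoint parts \<open>a\<close>, \<open>b\<close> of comparable \<open>f\<close>-mass, separated points below \<open>a\<close> and below \<open>b\<close>
  are added up, and \<open>a\<close> itself is a further point.\<close>

lemma splitting_imp_separated:
  fixes f :: "'a::vector_lattice \<Rightarrow> real"
  assumes f: "linear f"
    and split: "\<And>w. 0 \<le> w \<Longrightarrow> w \<le> u \<Longrightarrow>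
      \<exists>a b. inf a b = 0 \<and> a + b = w \<and> f w / 4 \<le> f a \<and> f w / 4 \<le> f b"
    and w: "0 \<le> w" "w \<le> u"
  shows "\<exists>x. (\<forall>i<k::nat. 0 \<le> x i \<and> x i \<le> w \<and> f w / 4 \<le> f (x i) \<and> f w / 4 \<le> f (w - x i)) \<and>
    (\<forall>i<k. \<forall>j<k. i \<noteq> j \<longrightarrow> f w / 4 \<le> f \<bar>x i - x j\<bar>)"
  using w
proof (induction k arbitrary: w)
  case (Suc k)
  note fadd = linear_add[OF f]
  obtain a b where ab: "inf a b = 0" "a + b = w" "f w / 4 \<le> f a" "f w / 4 \<le> f b"
    using split[OF Suc.prems] by blast
  have fw: "f w = f a + f b" using fadd[of a b] ab(2) by simp
  note nn = disjoint_nonneg[OF ab(1)]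
  have "a \<le> w" "b \<le> w" using nn by (simp_all flip: ab(2))
  then have "a \<le> u" "b \<le> u" using Suc.prems by (auto intro: order_trans)
  from Suc.IH[OF nn(1) this(1)] obtain x where
    x: "\<forall>i<k. 0 \<le> x i \<and> x i \<le> a \<and> f a / 4 \<le> f (x i) \<and> f a / 4 \<le> f (a - x i)"
      "\<forall>i<k. \<forall>j<k. i \<noteq> j \<longrightarrow> f a / 4 \<le> f \<bar>x i - x j\<bar>"
    by (elim exE conjE)
  from Suc.IH[OF nn(2) \<open>b \<le> u\<close>] obtain y where
    y: "\<forall>i<k. 0 \<le> y i \<and> y i \<le> b \<and> f b / 4 \<le> f (y i) \<and> f b / 4 \<le> f (b - y i)"
      "\<forall>i<k. \<forall>j<k. i \<noteq> j \<longrightarrow> f b / 4 \<le> f \<bar>y i - y j\<bar>"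
    by (elim exE conjE)
  note x = x[rule_format] and y = y[rule_format]
  have abs_le: "\<bar>c - d\<bar> \<le> e" if "0 \<le> c" "c \<le> e" "0 \<le> d" "d \<le> e" for c d e :: 'a
  proof (rule abs_leI)
    show "c - d \<le> e" using that by (simp add: diff_le_eq add_increasing2)
    show "- (c - d) \<le> e" using that by (simp add: diff_le_eq add_increasing2)
  qed
  \<comment> \<open>Additivity of \<open>f\<close> over the two disjoint halves reproduces the bound
    \<open>f w / 4\<close> from \<open>f a / 4\<close> and \<open>f b / 4\<close>, so the constant
    does not decay with \<open>k\<close>.\<close>
  define z where "z i = (if i < k then x i + y i else a)" for i
  have z1: "0 \<le> z i \<and> z i \<le> w \<and> f w / 4 \<le> f (z i) \<and> f w / 4 \<le> f (w - z i)" if "i < Suc k" for i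
  proof (cases "i < k")
    case True
    have "w - z i = (a - x i) + (b - y i)" using True ab(2) by (simp add: z_def algebra_simps)
    then have "f (w - z i) = f (a - x i) + f (b - y i)" by (simp add: fadd)
    moreover have "f (z i) = f (x i) + f (y i)" using True by (simp add: z_def fadd)
    moreover have "0 \<le> z i" "z i \<le> a + b"
      using x(1)[OF True] y(1)[OF True] True by (simp_all add: z_def add_mono)
    ultimately show ?thesis using x(1)[OF True] y(1)[OF True] fw ab(2) by simp
  next
    case False
    have "w - a = b" using ab(2) by (simp add: algebra_simps)
    then show ?thesis using False ab nn \<open>a \<le> w\<close> by (simp add: z_def)
  qed
  \<comment> \<open>The two-sided mass bounds in the induction hypothesis serve here: the distance
    from \<open>a\<close> is the missing part \<open>a - x i\<close> plus the surplus
    \<open>y i\<close>.\<close>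
  have new: "f w / 4 \<le> f \<bar>z i - a\<bar>" if "i < k" for i
  proof -
    have "z i - a = (x i - a) + y i" using that by (simp add: z_def)
    also have "\<bar>\<dots>\<bar> = \<bar>x i - a\<bar> + \<bar>y i\<bar>"
      using x(1)[OF that] y(1)[OF that] nn by (intro abs_add_disjoint[OF ab(1)] abs_le) auto
    also have "\<bar>x i - a\<bar> = a - x i" using x(1)[OF that] by (simp add: abs_of_nonpos)
    finally show ?thesis using x(1)[OF that] y(1)[OF that] fw by (simp add: fadd)
  qed
  have "f w / 4 \<le> f \<bar>z i - z j\<bar>" if ij: "i < Suc k" "j < Suc k" "i \<noteq> j" for i j
  proof -
    consider "i < k" "j < k" | "i < k" "j = k" | "i = k" "j < k" using ij by linarith
    then show ?thesis
    proof cases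
      case 1
      have "z i - z j = (x i - x j) + (y i - y j)" using 1 by (simp add: z_def)
      also have "\<bar>\<dots>\<bar> = \<bar>x i - x j\<bar> + \<bar>y i - y j\<bar>"
        using x(1) y(1) 1 by (intro abs_add_disjoint[OF ab(1)] abs_le) auto
      finally show ?thesis using x(2)[OF 1 ij(3)] y(2)[OF 1 ij(3)] fw by (simp add: fadd)
    next
      case 2
      then show ?thesis using new by (simp add: z_def)
    next
      case 3
      then show ?thesis using new[of j] by (simp add: z_def abs_minus_commute)
    qed
  qed
  with z1 show ?case by blast
qed simp

subsection \<open>Existence of atoms\<close>

context um_compact
begin

text \<open>\<open>c\<close> is the projection of \<open>w\<close> onto the band generated by
  \<open>v\<close>, a supremum provided by the Levi property. That it is a component follows by
  showing that \<open>c - z\<close> is still an upper bound for the overlap \<open>z\<close>; the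
  same device first shows that \<open>w - c\<close> is disjoint from \<open>v\<close>.\<close>

lemma principal_projection:
  fixes w v :: 'a
  assumes w: "0 \<le> w" and v: "0 \<le> v"
  obtains c where "component w c" "\<And>n::nat. inf w (real n *\<^sub>R v) \<le> c"
    "\<And>z. (\<And>n::nat. inf w (real n *\<^sub>R v) \<le> z) \<Longrightarrow> c \<le> z"
proof -
  define g where "g n = inf w (real n *\<^sub>R v)" for n
  have g0: "0 \<le> g n" for n using w v by (simp add: g_def scaleR_nonneg_nonneg)
  have gw: "g n \<le> w" for n by (simp add: g_def)
  have mono: "g m \<le> g n" if "m \<le> n" for m n
    unfolding g_def using that v by (intro inf_mono scaleR_right_mono) auto
  have "\<exists>c. increases_to UNIV (\<le>) g c"
  proof (rule levi_property_net[OF compact_imp_levi])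
    show "directed_index UNIV ((\<le>) :: nat \<Rightarrow> _)"
      unfolding directed_index_def by (auto simp: reflp_on_def transp_on_def intro: le_cases)
    show "monotone_on UNIV (\<le>) (\<le>) g" using mono by (auto simp: monotone_on_def)
    show "m_bounded M (range g)"
      unfolding m_bounded_def
    proof
      fix p assume "p \<in> M"
      then have "p (g n) \<le> p w" for n
        using g0 gw mnvl_seminorm[OF M] by (intro lattice_seminorm_mono) auto
      then show "bdd_above (p ` range g)" by (auto simp: bdd_above_def)
    qed
  qed (rule g0)
  then obtain c where c: "isLub UNIV (range g) c" by (auto simp: increases_to_def)
  have ub: "g n \<le> c" for n using isLubD2[OF c] by blast
  have lub: "c \<le> z" if "\<And>n. g n \<le> z" for z
    using isLub_le_isUb[OF c, of z] that by (auto simp: isUb_def setle_def)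
  have cw: "0 \<le> c" "c \<le> w" using lub[OF gw] order_trans[OF g0 ub] by auto
  have disj: "inf (w - c) v = 0"
  proof -
    define z where "z = inf (w - c) v"
    have z: "0 \<le> z" "z \<le> w - c" "z \<le> v" using cw v by (auto simp: z_def)
    have "g n \<le> c - z" for n
    proof -
      have "z + g n \<le> (w - c) + c" using z(2) ub by (rule add_mono)
      moreover have "z + g n \<le> v + real n *\<^sub>R v" using z(3) by (rule add_mono) (simp add: g_def)
      ultimately have "z + g n \<le> g (Suc n)" by (simp add: g_def algebra_simps)
      also have "\<dots> \<le> c" by (rule ub)
      finally show ?thesis by (simp add: algebra_simps)
    qed
    then have "c \<le> c - z" by (rule lub)
    then have "z = 0" using z(1) by simp
    then show ?thesis by (simp only: z_def)
  qed
  have "component w c"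
  proof -
    define z where "z = inf c (w - c)"
    have z: "0 \<le> z" "z \<le> c" "z \<le> w - c" using cw by (auto simp: z_def)
    have "g n \<le> c - z" for n
    proof -
      have "inf (w - c) (real n *\<^sub>R v) = 0" using disj by (rule disjoint_scaleR) simp
      then have "inf z (g n) = 0"
        by (rule disjoint_mono) (use z g0 in \<open>auto simp: g_def\<close>)
      then have "z + g n \<le> c" using z(2) ub by (rule disjoint_add_le)
      then show ?thesis by (simp add: algebra_simps)
    qed
    then have "c \<le> c - z" by (rule lub)
    then have "z = 0" using z(1) by simp
    then show ?thesis by (simp only: component_def z_def)
  qed
  then show thesis using ub lub that unfolding g_def by blast
qed

text \<open>Project \<open>w\<close> onto the band of the positive part \<open>v\<close> of
  \<open>y - s *\<^sub>R w\<close>. If the projection is 0, then \<open>v\<close> is disjoint from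
  \<open>w\<close>; if it is \<open>w\<close>, then the negative part \<open>v'\<close> is. Both
  parts lie below multiples of \<open>w\<close>, so the one disjoint from \<open>w\<close>
  vanishes.\<close>

lemma trivial_components_imp_comparable:
  fixes w y :: 'a
  assumes w: "0 < w" and triv: "\<And>c. component w c \<Longrightarrow> c = 0 \<or> c = w"
    and y: "0 \<le> y" "y \<le> k *\<^sub>R w" and k: "0 \<le> k" and s: "0 < s"
  shows "y \<le> s *\<^sub>R w \<or> s *\<^sub>R w \<le> y"
proof -
  define v where "v = pprt (y - s *\<^sub>R w)"
  define v' where "v' = pprt (- (y - s *\<^sub>R w))"
  have v0: "0 \<le> v" "0 \<le> v'" by (simp_all add: v_def v'_def)
  have sw: "0 \<le> s *\<^sub>R w" using s w by (simp add: scaleR_nonneg_nonneg)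
  have "y - s *\<^sub>R w \<le> y" using sw by simp
  then have v: "v \<le> k *\<^sub>R w" using y by (simp add: v_def pprt_le_iff order_trans[OF _ y(2)])
  have v': "v' \<le> s *\<^sub>R w" using y sw by (simp add: v'_def pprt_le_iff)
  obtain c where c: "component w c" "\<And>n::nat. inf w (real n *\<^sub>R v) \<le> c"
      "\<And>z. (\<And>n::nat. inf w (real n *\<^sub>R v) \<le> z) \<Longrightarrow> c \<le> z"
    using principal_projection[OF less_imp_le[OF w] v0(1)] by blast
  show ?thesis
  proof (cases "c = 0")
    case True
    then have "inf v w = 0" using c(2)[of 1] v0 w by (intro antisym) (simp_all add: inf_commute)
    then have "inf v (k *\<^sub>R w) = 0" using k by (rule disjoint_scaleR)
    then have "v = 0" using v by (rule disjoint_self)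
    then show ?thesis by (simp add: v_def flip: le_zero_iff_zero_pprt)
  next
    case False
    then have cw: "c = w" using triv c(1) by blast
    define z where "z = inf w v'"
    have z: "0 \<le> z" "z \<le> v'" "z \<le> c" using w v0 by (auto simp: z_def cw)
    have "inf w (real n *\<^sub>R v) \<le> c - z" for n :: nat
    proof -
      have "inf v' v = 0" using pprt_disjoint[of "y - s *\<^sub>R w"] by (simp add: v_def v'_def inf_commute)
      then have "inf v' (real n *\<^sub>R v) = 0" by (rule disjoint_scaleR) simp
      then have "inf z (inf w (real n *\<^sub>R v)) = 0"
        by (rule disjoint_mono) (use z v0 w in \<open>auto intro: scaleR_nonneg_nonneg\<close>)
      then have "z + inf w (real n *\<^sub>R v) \<le> c" using z(3) c(2) by (rule disjoint_add_le)
      then show ?thesis by (simp add: algebra_simps)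
    qed
    then have "c \<le> c - z" by (rule c(3))
    then have "z = 0" using z(1) by simp
    then have "inf v' w = 0" by (simp add: z_def inf_commute)
    then have "inf v' (s *\<^sub>R w) = 0" using s by (intro disjoint_scaleR) auto
    then have "v' = 0" using v' by (rule disjoint_self)
    then show ?thesis by (simp add: v'_def flip: le_zero_iff_zero_pprt)
  qed
qed

text \<open>After subtraction of the largest multiple \<open>t *\<^sub>R w\<close>, the rest of
  \<open>y\<close> dominates no \<open>s *\<^sub>R w\<close> with \<open>s > 0\<close>. By
  comparability it lies below all of them, so it is 0 by the Archimedean property.\<close>

lemma trivial_components_imp_atom:
  fixes w :: 'a
  assumes w: "0 < w" and triv: "\<And>c. component w c \<Longrightarrow> c = 0 \<or> c = w"
  shows "atom w"
proof (rule atomI_multiples[OF w])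
  fix y k assume y: "0 \<le> y" "y \<le> k *\<^sub>R w" and k: "0 \<le> (k::real)"
  obtain t where t: "t \<ge> 0" "t *\<^sub>R w \<le> y" "\<And>s. s *\<^sub>R w \<le> y \<Longrightarrow> s \<le> t"
    using mnvl_max_multiple[OF M w y(1)] by blast
  have "y - t *\<^sub>R w \<le> 0"
  proof (rule mnvl_archimedean[OF M])
    fix s :: real assume s: "0 < s"
    have tw: "0 \<le> t *\<^sub>R w" using t w by (simp add: scaleR_nonneg_nonneg)
    then have "y - t *\<^sub>R w \<le> y" by simp
    then have "y - t *\<^sub>R w \<le> k *\<^sub>R w" using y(2) by (rule order_trans)
    moreover have "\<not> s *\<^sub>R w \<le> y - t *\<^sub>R w"
    proof
      assume "s *\<^sub>R w \<le> y - t *\<^sub>R w"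
      then have "(t + s) *\<^sub>R w \<le> y" by (simp add: algebra_simps)
      then show False using t(3)[of "t + s"] s by simp
    qed
    ultimately show "y - t *\<^sub>R w \<le> s *\<^sub>R w"
      using trivial_components_imp_comparable[OF w triv _ _ k s, of "y - t *\<^sub>R w"] t(2) by simp
  qed
  then show "\<exists>t. y = t *\<^sub>R w" using t(2) by (intro exI[of _ t] antisym) auto
qed

text \<open>The Levi property applied to the increasing net \<open>w - d\<close> gives the infimum;
  the Lebesgue property applied to \<open>d - m\<close> gives the approximation in each
  seminorm.\<close>

lemma downward_directed_inf:
  fixes D :: "'a set"
  assumes ne: "D \<noteq> {}" and dir: "\<And>c d. c \<in> D \<Longrightarrow> d \<in> D \<Longrightarrow> inf c d \<in> D"
    and bounds: "\<And>d. d \<in> D \<Longrightarrow> 0 \<le> d \<and> d \<le> w"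
  shows "\<exists>m. (\<forall>d\<in>D. m \<le> d) \<and> (\<forall>z. (\<forall>d\<in>D. z \<le> d) \<longrightarrow> z \<le> m) \<and>
    (\<forall>p\<in>M. \<forall>\<epsilon>>0. \<exists>d\<in>D. p (d - m) < \<epsilon>)"
proof -
  have di: "directed_index D (\<ge>)"
    unfolding directed_index_def
  proof (intro conjI ballI)
    show "\<exists>k\<in>D. k \<le> i \<and> k \<le> j" if "i \<in> D" "j \<in> D" for i j
      using dir[OF that] by (intro bexI[of _ "inf i j"]) auto
  qed (use ne in \<open>auto simp: reflp_on_def transp_on_def\<close>)
  have "\<exists>l. increases_to D (\<ge>) (\<lambda>d. w - d) l"
  proof (rule levi_property_net[OF compact_imp_levi di])
    show "m_bounded M ((\<lambda>d. w - d) ` D)"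
      unfolding m_bounded_def
    proof
      fix p assume "p \<in> M"
      then have "p (w - d) \<le> p w" if "d \<in> D" for d
        using bounds[OF that] mnvl_seminorm[OF M] by (intro lattice_seminorm_mono) auto
      then show "bdd_above (p ` (\<lambda>d. w - d) ` D)" by (auto simp: bdd_above_def)
    qed
  qed (use bounds in \<open>auto simp: monotone_on_def intro: diff_left_mono\<close>)
  then obtain l where l: "isLub UNIV ((\<lambda>d. w - d) ` D) l" by (auto simp: increases_to_def)
  define m where "m = w - l"
  have lower: "m \<le> d" if "d \<in> D" for d
  proof -
    have "w - d \<le> l" using isLubD2[OF l] that by blast
    then show ?thesis by (simp add: m_def algebra_simps)
  qed
  have greatest: "z \<le> m" if z: "\<And>d. d \<in> D \<Longrightarrow> z \<le> d" for z
  proof -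
    have "isUb UNIV ((\<lambda>d. w - d) ` D) (w - z)"
      using z by (auto simp: isUb_def setle_def intro: diff_left_mono)
    then have "l \<le> w - z" by (rule isLub_le_isUb[OF l])
    then show ?thesis by (simp add: m_def algebra_simps)
  qed
  have "decreases_to D (\<ge>) (\<lambda>d. d - m) 0"
    unfolding decreases_to_def
  proof
    show "isGlb UNIV ((\<lambda>d. d - m) ` D) 0"
    proof (rule isGlbI2)
      show "isLb UNIV ((\<lambda>d. d - m) ` D) 0" using lower by (auto simp: isLb_def setge_def)
      show "Collect (isLb UNIV ((\<lambda>d. d - m) ` D)) *<= 0"
        unfolding setle_def
      proof
        fix z assume "z \<in> Collect (isLb UNIV ((\<lambda>d. d - m) ` D))"
        then have "z + m \<le> d" if "d \<in> D" for d
          using that by (auto simp: isLb_def setge_def le_diff_eq)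
        then have "z + m \<le> m" by (rule greatest)
        then show "z \<le> 0" by simp
      qed
    qed
  qed (auto simp: monotone_on_def)
  then have "m_converges M D (\<ge>) (\<lambda>d. d - m) 0"
    by (rule lebesgue_property_net[OF compact_imp_lebesgue di])
  then have conv: "\<exists>d\<in>D. p (d - m) < \<epsilon>" if "p \<in> M" "0 < \<epsilon>" for p and \<epsilon> :: real
    using that unfolding m_converges_def by fastforce
  show ?thesis using lower greatest conv by blast
qed

text \<open>If \<open>w\<close> admits no splitting, the components of \<open>w\<close> of large mass form a filter, whose infimum
  has only trivial components.\<close>

lemma atomless_splitting:
  assumes p: "p \<in> M" and f: "linear f" "\<And>x. f x \<le> p x" "\<And>x. 0 \<le> x \<Longrightarrow> 0 \<le> f x"
    and w: "0 \<le> w" and atomless: "\<And>e. atom e \<Longrightarrow> \<not> e \<le> w"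
  shows "\<exists>a b. inf a b = 0 \<and> a + b = w \<and> f w / 4 \<le> f a \<and> f w / 4 \<le> f b"
proof (cases "f w = 0")
  case True
  then show ?thesis using w linear_0[OF f(1)]
    by (intro exI[of _ 0] exI[of _ w]) (simp add: inf_absorb1)
next
  case False
  then have fw: "0 < f w" using f(3)[OF w] by simp
  note fadd = linear_add[OF f(1)] and fdiff = linear_diff[OF f(1)]
  show ?thesis
  proof (rule ccontr)
    assume contr: "\<not> ?thesis"
    \<comment> \<open>A component and its complement form a candidate splitting, so one of the two
      must carry less than a quarter.\<close>
    have dich: "f c < f w / 4 \<or> 3/4 * f w < f c" if "component w c" for c
    proof (rule ccontr)
      assume "\<not> ?thesis"
      then have "f w / 4 \<le> f c" "f w / 4 \<le> f (w - c)" by (simp_all add: fdiff)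
      moreover have "inf c (w - c) = 0" "c + (w - c) = w" using that by (simp_all add: component_def)
      ultimately show False using contr by blast
    qed
    define D where "D = {c. component w c \<and> 3/4 * f w < f c}"
    have ne: "D \<noteq> {}" using component_self[OF w] fw by (auto simp: D_def)
    have dir: "inf c d \<in> D" if cd: "c \<in> D" "d \<in> D" for c d
    proof -
      have comp: "component w c" "component w d" using cd by (auto simp: D_def)
      have "f c + f d = f (sup c d) + f (inf c d)"
        using add_eq_inf_sup[of c d] by (metis fadd)
      moreover have "f (sup c d) \<le> f w"
        using f(3)[of "w - sup c d"] component_bounds(2)[OF comp(1)] component_bounds(2)[OF comp(2)]
        by (simp add: fdiff del: diff_sup_eq_inf)
      \<comment> \<open>The meet carries more than 3/4 + 3/4 - 1 = 1/2 of the mass, and the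
        dichotomy raises this to more than 3/4.\<close>
      ultimately have "\<not> f (inf c d) < f w / 4" using cd fw by (auto simp: D_def)
      then show ?thesis using dich component_inf[OF comp] by (auto simp: D_def)
    qed
    have bounds: "0 \<le> d \<and> d \<le> w" if "d \<in> D" for d
      using that component_bounds by (auto simp: D_def)
    have "\<exists>m. (\<forall>d\<in>D. m \<le> d) \<and> (\<forall>z. (\<forall>d\<in>D. z \<le> d) \<longrightarrow> z \<le> m) \<and>
        (\<forall>p\<in>M. \<forall>\<epsilon>>0. \<exists>d\<in>D. p (d - m) < \<epsilon>)"
      by (rule downward_directed_inf[OF ne, of w]) (rule dir bounds, assumption+)+
    then obtain m where m: "\<forall>d\<in>D. m \<le> d" "\<forall>z. (\<forall>d\<in>D. z \<le> d) \<longrightarrow> z \<le> m"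
        "\<forall>p\<in>M. \<forall>\<epsilon>>0. \<exists>d\<in>D. p (d - m) < \<epsilon>"
      by (elim exE conjE)
    note m = m[rule_format]
    have m0: "0 \<le> m" using bounds by (intro m(2)) simp
    obtain d1 where "d1 \<in> D" using ne by blast
    then have "m \<le> d1" "d1 \<le> w" using m(1) bounds by auto
    then have mw: "m \<le> w" by (rule order_trans)
    have comp_m: "component w m"
    proof -
      define g where "g = inf m (w - m)"
      have g0: "0 \<le> g" using m0 mw by (simp add: g_def)
      have "m + g \<le> d" if d: "d \<in> D" for d
      proof -
        \<comment> \<open>Since \<open>d\<close> is disjoint from \<open>w - d\<close>, the overlap
          \<open>g\<close> fits into the gap \<open>d - m\<close>; hence \<open>m + g\<close> is a
          lower bound of \<open>D\<close> as well.\<close>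
        have "g \<le> inf d ((w - d) + (d - m))" using m(1)[OF d] by (auto simp: g_def le_infI1)
        also have "\<dots> \<le> inf d (w - d) + inf d (d - m)"
          using bounds[OF d] m(1)[OF d] by (intro inf_add_le) auto
        also have "\<dots> \<le> d - m" using d by (simp add: D_def component_def)
        finally show ?thesis by (simp add: algebra_simps)
      qed
      then have "m + g \<le> m" by (rule m(2))
      then have "g = 0" using g0 by simp
      then show ?thesis by (simp only: component_def g_def)
    qed
    have "3/4 * f w \<le> f m"
    proof (rule field_le_epsilon)
      fix \<epsilon> :: real assume "0 < \<epsilon>"
      then obtain d where d: "d \<in> D" "p (d - m) < \<epsilon>" using m(3)[OF p] by blast
      then have "f d - f m < \<epsilon>" using f(2)[of "d - m"] by (simp add: fdiff)
      then show "3/4 * f w \<le> f m + \<epsilon>" using d by (simp add: D_def)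
    qed
    then have "m \<noteq> 0" using fw linear_0[OF f(1)] by auto
    then have mpos: "0 < m" using m0 by simp
    have "c = 0 \<or> c = m" if c: "component m c" for c
    proof -
      have cw: "component w c" using comp_m c by (rule component_trans)
      \<comment> \<open>Either \<open>c\<close> or its complement in \<open>w\<close> belongs to
        \<open>D\<close> and hence dominates \<open>m\<close>.\<close>
      consider "3/4 * f w < f c" | "3/4 * f w < f (w - c)" using dich[OF cw] by (auto simp: fdiff)
      then show ?thesis
      proof cases
        case 1
        then have "m \<le> c" using cw by (intro m(1)) (simp add: D_def)
        then show ?thesis using component_bounds(2)[OF c] by auto
      next
        case 2
        then have "m \<le> w - c" using component_complement[OF cw] by (intro m(1)) (simp add: D_def)
        then have "c \<le> w - c" using component_bounds(2)[OF c] by (rule order_trans[rotated])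
        then show ?thesis using cw by (simp add: component_def inf_absorb1)
      qed
    qed
    then have "atom m" by (rule trivial_components_imp_atom[OF mpos])
    then show False using atomless mw by blast
  qed
qed

lemma atom_below_exists:
  fixes u :: 'a
  assumes u: "0 < u"
  shows "\<exists>e. atom e \<and> e \<le> u"
proof (rule ccontr)
  assume contr: "\<nexists>e. atom e \<and> e \<le> u"
  have u0: "0 \<le> u" using u by simp
  obtain p where p: "p \<in> M" "0 < p u" using mnvl_pos[OF M, of u] u by auto
  note sn = mnvl_seminorm[OF M p(1)]
  obtain f where f: "linear f" "\<And>x. f x \<le> p x" "\<And>x. 0 \<le> x \<Longrightarrow> 0 \<le> f x" "f u = p u"
    using lattice_seminorm_support[OF sn u0] by blast
  \<comment> \<open>Two points served by the same \<open>y\<close> are closer than twice this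
    radius, that is, than the separation \<open>p u / 4\<close>.\<close>
  have "0 < p u / 8" using p by simp
  then obtain Y where Y: "finite Y" "\<And>x. 0 \<le> x \<Longrightarrow> x \<le> u \<Longrightarrow> \<exists>y\<in>Y. p (inf \<bar>x - y\<bar> u) < p u / 8"
    by (rule order_interval_totally_bounded[OF p(1) u0]) blast
  define k where "k = Suc (card Y)"
  have split: "\<exists>a b. inf a b = 0 \<and> a + b = w \<and> f w / 4 \<le> f a \<and> f w / 4 \<le> f b"
    if "0 \<le> w" "w \<le> u" for w
  proof (rule atomless_splitting[OF p(1) f(1-3) that(1)])
    show "\<not> e \<le> w" if "atom e" for e using contr that \<open>w \<le> u\<close> by (blast intro: order_trans)
  qed
  obtain x where x: "\<And>i. i < k \<Longrightarrow> 0 \<le> x i \<and> x i \<le> u"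
      "\<And>i j. i < k \<Longrightarrow> j < k \<Longrightarrow> i \<noteq> j \<Longrightarrow> p u / 4 \<le> f \<bar>x i - x j\<bar>"
    using splitting_imp_separated[OF f(1) split u0 order_refl, of k] f(4) by auto
  have "\<forall>i\<in>{..<k}. \<exists>y. y \<in> Y \<and> p (inf \<bar>x i - y\<bar> u) < p u / 8" using Y(2) x(1) by auto
  then obtain y where y: "\<And>i. i < k \<Longrightarrow> y i \<in> Y \<and> p (inf \<bar>x i - y i\<bar> u) < p u / 8"
    using bchoice[of "{..<k}" "\<lambda>i y. y \<in> Y \<and> p (inf \<bar>x i - y\<bar> u) < p u / 8"] by blast
  have "card (y ` {..<k}) \<le> card Y" using y Y(1) by (intro card_mono) auto
  then have "\<not> inj_on y {..<k}" by (intro pigeonhole) (simp add: k_def)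
  then obtain i j where ij: "i < k" "j < k" "i \<noteq> j" "y i = y j" by (auto simp: inj_on_def)
  \<comment> \<open>This removes the truncation at \<open>u\<close>, so that um-closeness of both
    points to one centre bounds \<open>p\<close> of their difference.\<close>
  have "\<bar>x i - x j\<bar> \<le> u"
  proof (rule abs_leI)
    show "x i - x j \<le> u" "- (x i - x j) \<le> u"
      using x(1)[OF ij(1)] x(1)[OF ij(2)] by (simp_all add: diff_le_eq add_increasing2)
  qed
  then have "\<bar>x i - x j\<bar> = inf \<bar>(x i - y i) + (y i - x j)\<bar> u" by (simp add: inf_absorb1)
  also have "\<dots> \<le> inf \<bar>x i - y i\<bar> u + inf \<bar>x j - y j\<bar> u"
    using inf_abs_add_le[OF u0, of "x i - y i" "y i - x j"] ij(4) by (simp add: abs_minus_commute)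
  finally have "p \<bar>x i - x j\<bar> \<le> p (inf \<bar>x i - y i\<bar> u + inf \<bar>x j - y j\<bar> u)"
    by (intro lattice_seminorm_mono[OF sn]) auto
  also have "\<dots> \<le> p (inf \<bar>x i - y i\<bar> u) + p (inf \<bar>x j - y j\<bar> u)"
    by (rule lattice_seminorm_triangle[OF sn])
  also have "\<dots> < p u / 8 + p u / 8" using y[OF ij(1)] y[OF ij(2)] by linarith
  finally show False using x(2)[OF ij(1-3)] f(2)[of "\<bar>x i - x j\<bar>"] by simp
qed

text \<open>Take a maximal disjoint set of atoms by Zorn. A positive element disjoint from all of
  them would have an atom below it, and that atom could be added.\<close>

lemma compact_imp_atomic: "atomic_vector_lattice TYPE('a)"
proof -
  define \<A> where "\<A> = {E :: 'a set. (\<forall>e\<in>E. atom e) \<and> pairwise (\<lambda>e f. inf e f = 0) E}"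
  have "\<exists>E\<in>\<A>. \<forall>F\<in>\<A>. E \<subseteq> F \<longrightarrow> F = E"
  proof (rule subset_Zorn')
    fix \<C> assume C: "subset.chain \<A> \<C>"
    have "pairwise (\<lambda>e f. inf e f = 0) (\<Union>\<C>)"
      unfolding pairwise_def
    proof (intro ballI impI)
      fix e f assume "e \<in> \<Union>\<C>" "f \<in> \<Union>\<C>" "e \<noteq> f"
      then obtain E F where EF: "e \<in> E" "E \<in> \<C>" "f \<in> F" "F \<in> \<C>" by blast
      then have "E \<subseteq> F \<or> F \<subseteq> E" using C by (auto simp: subset_chain_def)
      then obtain G where "G \<in> \<C>" "e \<in> G" "f \<in> G" using EF by blast
      then show "inf e f = 0"
        using C \<open>e \<noteq> f\<close> by (auto simp: subset_chain_def \<A>_def pairwise_def)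
    qed
    then show "\<Union>\<C> \<in> \<A>" using C by (auto simp: \<A>_def subset_chain_def)
  qed
  then obtain E where E: "E \<in> \<A>" "\<And>F. F \<in> \<A> \<Longrightarrow> E \<subseteq> F \<Longrightarrow> F = E" by blast
  have "x = 0" if x: "0 \<le> x" "\<forall>e\<in>E. inf x e = 0" for x
  proof (rule ccontr)
    assume "x \<noteq> 0"
    then have "0 < x" using x(1) by simp
    then obtain a where a: "atom a" "a \<le> x" using atom_below_exists by blast
    then have a0: "0 < a" by (simp add: atom_def)
    have disj: "inf a e = 0" if "e \<in> E" for e
    proof (rule disjoint_mono)
      show "inf x e = 0" using x(2) that by blast
      then show "0 \<le> e" by (rule disjoint_nonneg)
    qed (use a a0 in auto)
    have "insert a E \<in> \<A>"
      using E(1) a(1) disj by (auto simp: \<A>_def pairwise_insert inf_commute)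
    then have "a \<in> E" using E(2) by blast
    then show False using disj a0 by force
  qed
  then show ?thesis using E(1) unfolding atomic_vector_lattice_def \<A>_def by blast
qed

end

theorem theorem6:
  fixes M :: "('a::vector_lattice \<Rightarrow> real) set"
  assumes "mnvl M"
  shows "(\<forall>A. m_bounded M A \<and> closedin (um_topology M) A \<longrightarrow> compactin (um_topology M) A) \<longleftrightarrow>
    atomic_vector_lattice TYPE('a) \<and> lebesgue_property M \<and> levi_property M"
proof
  assume "\<forall>A. m_bounded M A \<and> closedin (um_topology M) A \<longrightarrow> compactin (um_topology M) A"
  then interpret um_compact M using assms by unfold_locales auto
  show "atomic_vector_lattice TYPE('a) \<and> lebesgue_property M \<and> levi_property M"
    using compact_imp_atomic compact_imp_lebesgue compact_imp_levi by blast
next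
  assume "atomic_vector_lattice TYPE('a) \<and> lebesgue_property M \<and> levi_property M"
  then show "\<forall>A. m_bounded M A \<and> closedin (um_topology M) A \<longrightarrow> compactin (um_topology M) A"
    using atomic_lebesgue_levi_imp_compact[OF assms] by blast
qed

end
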